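(* For every $R>0$, the magnitude of the closed Euclidean ball of radius $R$ in $\mathbb{R}^5$ is $$\frac{R^5}{5!}+\frac{3R^5+27R^4+105R^3+216R^2+216R+72}{24(R+3)}.$$
   Context: Subsets of $\mathbb{R}^n$ carry the Euclidean metric; $\omega_n$ is the volume of the unit ball in $\mathbb{R}^n$. Magnitude: for a finite metric space $(\Xi,d)$, if $w:\Xi\to\mathbb{R}$ satisfies $\sum_{y\in \Xi}e^{-d(x,y)}w(y)=1$ for all $x\in \Xi$, then $|\Xi|:=\sum_{x\in \Xi}w(x)$ (independent of the choice of $w$; such $w$ exists for every finite subset of a Euclidean space). For a compact set $X\subseteq\mathbb{R}^n$, the magnitude is $|X|:=\sup\{|\Xi| : \Xi \text{ a finite subset of } X\}$. By a known theorem of Meckes, for compact $X\subseteq\mathbb{R}^n$ this equals $$|X|=\frac{1}{n!\,\omega_n}\inf\left\{\|f\|^2_{H^{(n+1)/2}(\mathbb{R}^n)} : f\in H^{(n+1)/2}(\mathbb{R}^n),\ f\equiv 1\text{ on }X\right\},$$ where $\|f\|^2_{H^{m}(\mathbb{R}^n)}=\|(I-\Delta)^{m/2}f\|^2_{L^2(\mathbb{R}^n)}$. *)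

theory Defs
  imports "HOL-Analysis.Analysis"
begin

definition weighting :: "'a::metric_space set \<Rightarrow> ('a \<Rightarrow> real) \<Rightarrow> bool" where
  "weighting A w \<longleftrightarrow> (\<forall>x\<in>A. (\<Sum>y\<in>A. exp (- dist x y) * w y) = 1)"

text \<open>Meaningful for finite sets that admit a weighting, which includes every finite subset of a
  Euclidean space; the lemma below shows that the choice of weighting is then immaterial.\<close>

definition finite_magnitude :: "'a::metric_space set \<Rightarrow> real" where
  "finite_magnitude A = (\<Sum>x\<in>A. (SOME w. weighting A w) x)"

lemma weighting_sum_unique:
  assumes "weighting A v" and "weighting A w"
  shows "(\<Sum>x\<in>A. v x) = (\<Sum>x\<in>A. w x)"
proof -
  have "(\<Sum>x\<in>A. v x) = (\<Sum>x\<in>A. \<Sum>y\<in>A. v x * (exp (- dist x y) * w y))"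
    using assms(2) by (simp add: weighting_def flip: sum_distrib_left)
  also have "\<dots> = (\<Sum>y\<in>A. \<Sum>x\<in>A. w y * (exp (- dist y x) * v x))"
    by (subst sum.swap) (simp add: dist_commute mult_ac)
  also have "\<dots> = (\<Sum>y\<in>A. w y)"
    using assms(1) by (simp add: weighting_def flip: sum_distrib_left)
  finally show ?thesis .
qed

lemma finite_magnitude_eq:
  assumes "weighting A w"
  shows "finite_magnitude A = (\<Sum>x\<in>A. w x)"
  unfolding finite_magnitude_def
  by (rule weighting_sum_unique [OF someI [of "weighting A", OF assms] assms])

text \<open>Intended for compact subsets of Euclidean spaces. The supremum is taken in the extended
  reals, so that an equation with a real right-hand side includes boundedness of the magnitudes of
  the finite subsets.\<close>

definition magnitude :: "'a::metric_space set \<Rightarrow> ereal" where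
  "magnitude X = (SUP A\<in>{A. finite A \<and> A \<subseteq> X}. ereal (finite_magnitude A))"

end

theory Submission
  imports Defs "HOL-Probability.Distributions" "HOL-Real_Asymp.Real_Asymp"
    "HOL-Computational_Algebra.Polynomial"
begin

text \<open>The kernel \<open>exp (- dist x y)\<close> is positive definite: by subordination it is a mixture of Gaussians.
  Hence \<open>2 \<Sum>v - E v \<le> |F|\<close> for every weight \<open>v\<close> on a finite set \<open>F\<close>, where \<open>E v\<close> is its energy, and
  \<open>|A| \<le> E v\<close> whenever the potential of \<open>v\<close> is 1 on \<open>A\<close>. It therefore suffices to find weights
  supported (almost) in the ball whose potential is almost 1 on it and whose mass and energy both
  tend to the claimed value. Inside a ball of radius \<open>s\<close> the potential of Lebesgue measure is
  \<open>64 \<pi>\<^sup>2\<close> plus a combination of three fixed radial functions with coefficients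
  \<open>exp (- s) \<theta>\<^sub>k s\<close>. A suitable combination of four concentric balls of radii
  \<open>s, s + e, s + 2 e, s + 3 e\<close> cancels these three functions, so that its potential is exactly 1 on the
  ball of radius \<open>s\<close>; on the remaining thin shell the potential is close enough to 1 for energy and
  mass to have the same limit as \<open>e \<rightarrow> 0\<close>. The limit of the mass is a ratio of two Wronskians.\<close>

section \<open>Positive definiteness of the exponential kernel\<close>

text \<open>In five dimensions \<open>exp (- dist x y)\<close> is 64 pi^2 times the fundamental
  solution of the third power of I - \<Delta>, and 64 pi^2 is its integral over the whole space.
  Inside a ball the potential of Lebesgue measure minus 64 pi^2 is thus a regular radial solution of
  the homogeneous equation. These solutions form a three-dimensional space, which accounts for the
  three radial functions. Four balls serve three cancellations and one normalisation. The summand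
  R^5 / 5! of the result is the volume divided by 64 pi^2. The obstacle is that the exact weighting
  of the ball is not a function: it is the density 1 / (64 pi^2) plus layers on the sphere that
  involve normal derivatives of the surface measure up to the second. Difference quotients of
  indicators of balls up to order three imitate these layers. The price is weights that may grow
  like e^-3, so convergence of the energy is not automatic. It rests on the high order to which the
  inner and outer formulas of a ball potential agree at the boundary.\<close>

lemma inner_power_psd:
  fixes u :: "'a::euclidean_space \<Rightarrow> real"
  shows "(\<Sum>x\<in>S. \<Sum>y\<in>S. u x * u y * (x \<bullet> y) ^ n) \<ge> 0"
proof (induction n arbitrary: u)
  case 0
  have "(\<Sum>x\<in>S. \<Sum>y\<in>S. u x * u y) = (\<Sum>x\<in>S. u x)\<^sup>2"
    by (simp add: power2_eq_square sum_product)
  then show ?case by simp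
next
  case (Suc n)
  \<comment> \<open>Expanding one factor of the power over the basis turns the form into a sum of
    forms of degree \<open>n\<close> with coefficients \<open>u x * (x \<bullet> b)\<close>. Hence
    the induction is over arbitrary \<open>u\<close>.\<close>
  have "u x * u y * (x \<bullet> y) ^ Suc n = (\<Sum>b\<in>Basis. (u x * (x \<bullet> b)) * (u y * (y \<bullet> b)) * (x \<bullet> y) ^ n)"
    for x y :: 'a
  proof -
    have "u x * u y * (x \<bullet> y) ^ Suc n = (\<Sum>b\<in>Basis. (x \<bullet> b) * (y \<bullet> b)) * (u x * u y * (x \<bullet> y) ^ n)"
      by (simp flip: euclidean_inner)
    then show ?thesis
      by (simp only: sum_distrib_right) (simp add: mult_ac)
  qed
  then have "(\<Sum>x\<in>S. \<Sum>y\<in>S. u x * u y * (x \<bullet> y) ^ Suc n) =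
      (\<Sum>x\<in>S. \<Sum>y\<in>S. \<Sum>b\<in>Basis. (u x * (x \<bullet> b)) * (u y * (y \<bullet> b)) * (x \<bullet> y) ^ n)"
    by simp
  also have "\<dots> = (\<Sum>x\<in>S. \<Sum>b\<in>Basis. \<Sum>y\<in>S. (u x * (x \<bullet> b)) * (u y * (y \<bullet> b)) * (x \<bullet> y) ^ n)"
    by (intro sum.cong refl sum.swap)
  also have "\<dots> = (\<Sum>b\<in>Basis. \<Sum>x\<in>S. \<Sum>y\<in>S. (u x * (x \<bullet> b)) * (u y * (y \<bullet> b)) * (x \<bullet> y) ^ n)"
    by (rule sum.swap)
  also have "\<dots> \<ge> 0" by (intro sum_nonneg Suc)
  finally show ?case .
qed

text \<open>Factors depending on \<open>x\<close> or \<open>y\<close> alone can be absorbed into the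
  coefficients. What remains is \<open>exp (2 * l * (x \<bullet> y))\<close>, whose power series has
  nonnegative coefficients and positive semidefinite terms.\<close>

lemma gaussian_psd:
  fixes u :: "'a::euclidean_space \<Rightarrow> real"
  assumes "l \<ge> 0"
  shows "(\<Sum>x\<in>S. \<Sum>y\<in>S. u x * u y * exp (- l * (dist x y)\<^sup>2)) \<ge> 0"
proof -
  define v where "v x = u x * exp (- l * (norm x)\<^sup>2)" for x
  have "u x * u y * exp (- l * (dist x y)\<^sup>2) = v x * v y * exp (2 * l * (x \<bullet> y))" for x y
  proof -
    have "- l * (dist x y)\<^sup>2 = - l * (norm x)\<^sup>2 + (- l * (norm y)\<^sup>2) + 2 * l * (x \<bullet> y)"
      unfolding dist_norm power2_norm_eq_inner by (simp add: inner_diff inner_commute algebra_simps)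
    then have "exp (- l * (dist x y)\<^sup>2) =
        exp (- l * (norm x)\<^sup>2) * exp (- l * (norm y)\<^sup>2) * exp (2 * l * (x \<bullet> y))"
      by (simp only: exp_add)
    then show ?thesis by (simp add: v_def)
  qed
  moreover have "(\<lambda>n. \<Sum>x\<in>S. \<Sum>y\<in>S. v x * v y * ((2 * l * (x \<bullet> y)) ^ n /\<^sub>R fact n)) sums
      (\<Sum>x\<in>S. \<Sum>y\<in>S. v x * v y * exp (2 * l * (x \<bullet> y)))"
    by (intro sums_sum sums_mult exp_converges)
  moreover have "(\<Sum>x\<in>S. \<Sum>y\<in>S. v x * v y * ((2 * l * (x \<bullet> y)) ^ n /\<^sub>R fact n)) \<ge> 0" for n
  proof -
    have "(\<Sum>x\<in>S. \<Sum>y\<in>S. v x * v y * ((2 * l * (x \<bullet> y)) ^ n /\<^sub>R fact n)) =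
        (2 * l) ^ n / fact n * (\<Sum>x\<in>S. \<Sum>y\<in>S. v x * v y * (x \<bullet> y) ^ n)"
      by (simp add: sum_distrib_left power_mult_distrib divide_inverse mult_ac)
    also have "\<dots> \<ge> 0" using assms by (intro mult_nonneg_nonneg inner_power_psd) auto
    finally show ?thesis .
  qed
  ultimately show ?thesis
    using sums_le[OF _ sums_zero] by (metis (no_types, lifting) sum.cong)
qed

lemma subordination:
  fixes a :: real
  assumes "a \<ge> 0"
  shows "set_integrable lborel {0<..} (\<lambda>s. exp (- s\<^sup>2 - a\<^sup>2 / s\<^sup>2))" (is ?int)
    and "(LINT s:{0<..}|lborel. exp (- s\<^sup>2 - a\<^sup>2 / s\<^sup>2)) = sqrt pi / 2 * exp (- 2 * a)" (is ?eq)
proof -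
  define g where "g t = exp (- t\<^sup>2)" for t :: real
  have g0: "has_bochner_integral lborel (\<lambda>x. indicator {0..} x *\<^sub>R g x) (sqrt pi / 2)"
    unfolding g_def by (rule gaussian_moment_0)
  \<comment> \<open>This is the error function up to a constant factor. Both signs of the argument
    occur, because \<open>s - a / s\<close> changes sign for \<open>a > 0\<close>.\<close>
  define G where "G x = (LBINT t=0..ereal x. g t)" for x
  have G': "(G has_real_derivative g x) (at x)" for x
  proof -
    let ?c = "\<bar>x\<bar> + 1"
    have "((\<lambda>u. LBINT t=0..ereal u. g t) has_vector_derivative g x) (at x within {-?c..?c})"
      unfolding zero_ereal_def
      by (rule interval_integral_FTC2) (auto simp: g_def intro!: continuous_intros)
    then show ?thesis
      unfolding G_def has_real_derivative_iff_has_vector_derivative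
      by (subst (asm) at_within_interior) auto
  qed
  have Gc: "((\<lambda>s. G (h s)) has_real_derivative g (h s) * h') (at s)"
    if "(h has_real_derivative h') (at s)" for h h' s
    using DERIV_chain2[OF G' that] .
  have odd: "G (- x) = - G x" for x
  proof -
    have "((\<lambda>x. G x + G (- x)) has_real_derivative 0) (at x)" for x
      using DERIV_add[OF G'[of x] Gc[of uminus "- 1" x]]
      by (simp add: g_def DERIV_minus[OF DERIV_ident])
    then have "G x + G (- x) = G 0 + G (- 0)"
      by (intro DERIV_isconst_all) auto
    then show ?thesis by (simp add: G_def zero_ereal_def)
  qed
  have lim: "(G \<longlongrightarrow> sqrt pi / 2) at_top"
  proof -
    have "((\<lambda>y. \<integral>x. indicator {..y} x *\<^sub>R (indicator {0..} x *\<^sub>R g x) \<partial>lborel) \<longlongrightarrow>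
        (\<integral>x. indicator {0..} x *\<^sub>R g x \<partial>lborel)) at_top"
      using g0 by (intro tendsto_integral_at_top) (auto simp: has_bochner_integral_iff)
    moreover have "eventually (\<lambda>y. (\<integral>x. indicator {..y} x *\<^sub>R (indicator {0..} x *\<^sub>R g x) \<partial>lborel) = G y) at_top"
      using eventually_ge_at_top[of "0::real"]
    proof eventually_elim
      case (elim y)
      have "G y = (LBINT t:{0..y}. g t)" unfolding G_def zero_ereal_def
        using elim by (subst interval_integral_Icc) auto
      also have "\<dots> = (\<integral>x. indicator {..y} x *\<^sub>R (indicator {0..} x *\<^sub>R g x) \<partial>lborel)"
        unfolding set_lebesgue_integral_def
        by (intro Bochner_Integration.integral_cong) (auto simp: indicator_def)
      finally show ?case by simp
    qed
    moreover have "(\<integral>x. indicator {0..} x *\<^sub>R g x \<partial>lborel) = sqrt pi / 2"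
      using g0 by (rule has_bochner_integral_integral_eq)
    ultimately show ?thesis
      by (simp only: tendsto_cong)
  qed
  have lim': "(G \<longlongrightarrow> - (sqrt pi / 2)) at_bot"
  proof -
    have "((\<lambda>x. - G (- x)) \<longlongrightarrow> - (sqrt pi / 2)) at_bot"
      by (intro tendsto_minus filterlim_compose[OF lim] filterlim_uminus_at_top_at_bot)
    then show ?thesis by (simp add: odd)
  qed
  \<comment> \<open>The antiderivative comes from completing the square in two ways: the squares of
    \<open>s + a / s\<close> and \<open>s - a / s\<close> differ from the exponent by
    \<open>2 * a\<close> up to sign, and the inner derivatives \<open>1 - a / s\<^sup>2\<close> and
    \<open>1 + a / s\<^sup>2\<close> add up to 2.\<close>
  define F where "F s = (exp (2 * a) * G (s + a / s) + exp (- 2 * a) * G (s - a / s)) / 2" for s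
  define A where "A = (if a = 0 then 0 else (exp (2 * a) - exp (- 2 * a)) * sqrt pi / 4)"
  define B where "B = (exp (2 * a) + exp (- 2 * a)) * sqrt pi / 4"
  have F': "(F has_real_derivative exp (- s\<^sup>2 - a\<^sup>2 / s\<^sup>2)) (at s)" if "s > 0" for s
  proof -
    have 1: "(s + a / s)\<^sup>2 = s\<^sup>2 + a\<^sup>2 / s\<^sup>2 + 2 * a" "(s - a / s)\<^sup>2 = s\<^sup>2 + a\<^sup>2 / s\<^sup>2 - 2 * a"
      using that by (simp_all add: power2_eq_square field_simps)
    have 2: "exp (2 * a) * g (s + a / s) = exp (- s\<^sup>2 - a\<^sup>2 / s\<^sup>2)"
      "exp (- 2 * a) * g (s - a / s) = exp (- s\<^sup>2 - a\<^sup>2 / s\<^sup>2)"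
      unfolding g_def 1 by (simp_all flip: exp_add)
    have "((\<lambda>s. s + a / s) has_real_derivative 1 - a / s\<^sup>2) (at s)"
      "((\<lambda>s. s - a / s) has_real_derivative 1 + a / s\<^sup>2) (at s)"
      using that by (auto intro!: derivative_eq_intros simp: power2_eq_square)
    note 3 = this[THEN Gc]
    have "(F has_real_derivative (exp (2 * a) * (g (s + a / s) * (1 - a / s\<^sup>2)) +
        exp (- 2 * a) * (g (s - a / s) * (1 + a / s\<^sup>2))) / 2) (at s)"
      unfolding F_def by (intro DERIV_cdivide DERIV_add DERIV_cmult 3)
    also have "(exp (2 * a) * (g (s + a / s) * (1 - a / s\<^sup>2)) +
        exp (- 2 * a) * (g (s - a / s) * (1 + a / s\<^sup>2))) / 2 =
        ((exp (2 * a) * g (s + a / s)) * (1 - a / s\<^sup>2) +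
        (exp (- 2 * a) * g (s - a / s)) * (1 + a / s\<^sup>2)) / 2" by (simp only: mult.assoc)
    also have "\<dots> = exp (- s\<^sup>2 - a\<^sup>2 / s\<^sup>2)" unfolding 2 by (simp add: field_simps)
    finally show ?thesis .
  qed
  have limA: "(F \<longlongrightarrow> A) (at_right 0)"
  \<comment> \<open>For \<open>a = 0\<close> both arguments of \<open>G\<close> tend to 0; for
    \<open>a > 0\<close> they tend to plus and minus infinity.\<close>
  proof (cases "a = 0")
    case True
    have "isCont G 0" using G' DERIV_isCont by blast
    then have "(G \<longlongrightarrow> 0) (at_right 0)"
      unfolding isCont_def by (auto simp: G_def zero_ereal_def intro: tendsto_mono[OF at_le])
    then show ?thesis using True by (simp add: F_def[abs_def] A_def)
  next
    case False
    with assms have a: "a > 0" by simp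
    have "filterlim (\<lambda>s. s + a / s) at_top (at_right 0)" "filterlim (\<lambda>s. s - a / s) at_bot (at_right 0)"
      using a by real_asymp+
    then have "(F \<longlongrightarrow> (exp (2 * a) * (sqrt pi / 2) + exp (- 2 * a) * (- (sqrt pi / 2))) / 2) (at_right 0)"
      unfolding F_def by (intro tendsto_intros filterlim_compose[OF lim] filterlim_compose[OF lim']) auto
    also have "(exp (2 * a) * (sqrt pi / 2) + exp (- 2 * a) * (- (sqrt pi / 2))) / 2 = A"
      using False by (simp add: A_def field_simps)
    finally show ?thesis .
  qed
  have limB: "(F \<longlongrightarrow> B) at_top"
  proof -
    have "filterlim (\<lambda>s. s + a / s) at_top at_top" "filterlim (\<lambda>s. s - a / s) at_top at_top"
      by real_asymp+
    then have "(F \<longlongrightarrow> (exp (2 * a) * (sqrt pi / 2) + exp (- 2 * a) * (sqrt pi / 2)) / 2) at_top"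
      unfolding F_def by (intro tendsto_intros filterlim_compose[OF lim]) auto
    also have "(exp (2 * a) * (sqrt pi / 2) + exp (- 2 * a) * (sqrt pi / 2)) / 2 = B"
      by (simp add: B_def field_simps)
    finally show ?thesis .
  qed
  have E: "einterval 0 \<infinity> = {0<..}" by (auto simp: einterval_def zero_ereal_def)
  have FTC: "set_integrable lborel (einterval 0 \<infinity>) (\<lambda>s. exp (- s\<^sup>2 - a\<^sup>2 / s\<^sup>2))"
     "(LBINT s=0..\<infinity>. exp (- s\<^sup>2 - a\<^sup>2 / s\<^sup>2)) = B - A"
    using F' limA limB
    by (intro interval_integral_FTC_nonneg[where F=F];
        force simp: zero_ereal_def ereal_tendsto_simps intro!: continuous_intros)+
  show ?int using FTC(1) unfolding E .
  have "B - A = sqrt pi / 2 * exp (- 2 * a)"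
    by (simp add: A_def B_def algebra_simps field_simps)
  then show ?eq using FTC(2) unfolding interval_lebesgue_integral_def E by simp
qed

text \<open>\<open>subordination\<close> with \<open>a = dist x y / 2\<close> writes the form as an
  integral of the nonnegative Gaussian forms \<open>Q s\<close>. Strictness comes from
  \<open>s \<rightarrow> 0\<close>: the Gaussians concentrate on the diagonal, so the integrand
  tends to the sum of the squares of \<open>u\<close> and stays above half of it on an interval of
  positive length.\<close>

lemma exp_dist_pos_def:
  fixes u :: "'a::euclidean_space \<Rightarrow> real"
  assumes "finite S" "a \<in> S" "u a \<noteq> 0"
  shows "(\<Sum>x\<in>S. \<Sum>y\<in>S. u x * u y * exp (- dist x y)) > 0"
proof -
  define Q where "Q s = (\<Sum>x\<in>S. \<Sum>y\<in>S. u x * u y * exp (- (1 / (4 * s\<^sup>2)) * (dist x y)\<^sup>2))" for s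
  define q where "q = (\<Sum>x\<in>S. (u x)\<^sup>2)"
  have q: "q > 0"
    unfolding q_def using assms by (intro sum_pos2[of S a]) auto
  have kernel: "exp (- s\<^sup>2) * exp (- (1 / (4 * s\<^sup>2)) * (dist x y)\<^sup>2) =
      exp (- s\<^sup>2 - (dist x y / 2)\<^sup>2 / s\<^sup>2)" for s :: real and x y :: 'a
    by (simp add: power_divide flip: exp_add)
  have Q_eq: "exp (- s\<^sup>2) * Q s = (\<Sum>x\<in>S. \<Sum>y\<in>S. u x * u y * exp (- s\<^sup>2 - (dist x y / 2)\<^sup>2 / s\<^sup>2))" for s
    unfolding Q_def kernel[symmetric] by (simp add: sum_distrib_left mult_ac)
  have Q_nonneg: "Q s \<ge> 0" for s
    unfolding Q_def by (rule gaussian_psd) auto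
  have int1: "set_integrable lborel {0<..} (\<lambda>s. u x * u y * exp (- s\<^sup>2 - (dist x y / 2)\<^sup>2 / s\<^sup>2))" for x y
    using subordination(1)[of "dist x y / 2"] by (intro set_integrable_mult_right) auto
  have int: "set_integrable lborel {0<..} (\<lambda>s. exp (- s\<^sup>2) * Q s)"
    unfolding Q_eq using int1 by (simp add: set_integrable_def sum_distrib_left)
  have val: "(LINT s:{0<..}|lborel. exp (- s\<^sup>2) * Q s) =
      sqrt pi / 2 * (\<Sum>x\<in>S. \<Sum>y\<in>S. u x * u y * exp (- dist x y))"
  proof -
    have "(LINT s:{0<..}|lborel. exp (- s\<^sup>2) * Q s) =
        (\<Sum>x\<in>S. \<Sum>y\<in>S. LINT s:{0<..}|lborel. u x * u y * exp (- s\<^sup>2 - (dist x y / 2)\<^sup>2 / s\<^sup>2))"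
      unfolding Q_eq set_lebesgue_integral_def scaleR_sum_right using int1
      by (simp add: set_integrable_def Bochner_Integration.integral_sum)
    also have "\<dots> = (\<Sum>x\<in>S. \<Sum>y\<in>S. u x * u y * (sqrt pi / 2 * exp (- dist x y)))"
      by (simp add: subordination(2))
    finally show ?thesis by (simp add: sum_distrib_left mult_ac)
  qed
  have "((\<lambda>s. exp (- (1 / (4 * s\<^sup>2)) * (dist x y)\<^sup>2)) \<longlongrightarrow> (if x = y then 1 else 0)) (at_right 0)" for x y :: 'a
  proof (cases "x = y")
    case False
    then have "(dist x y)\<^sup>2 > 0" by simp
    then have "((\<lambda>s. exp (- (1 / (4 * s\<^sup>2)) * (dist x y)\<^sup>2)) \<longlongrightarrow> 0) (at_right 0)" by real_asymp
    then show ?thesis using False by simp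
  qed simp
  then have "(Q \<longlongrightarrow> (\<Sum>x\<in>S. \<Sum>y\<in>S. u x * u y * (if x = y then 1 else 0))) (at_right 0)"
    unfolding Q_def[abs_def] by (intro tendsto_intros)
  then have "((\<lambda>s. exp (- s\<^sup>2) * Q s) \<longlongrightarrow> exp (- 0\<^sup>2) * q) (at_right 0)"
    unfolding q_def using assms(1)
    by (intro tendsto_intros) (auto simp: if_distrib power2_eq_square cong: if_cong)
  then have "\<forall>\<^sub>F s in at_right 0. exp (- s\<^sup>2) * Q s > q / 2"
    using q by (intro order_tendstoD) auto
  then obtain s0 where s0: "s0 > 0" "\<And>s. 0 < s \<Longrightarrow> s < s0 \<Longrightarrow> exp (- s\<^sup>2) * Q s > q / 2"
    unfolding eventually_at_right_field by auto
  have "q / 2 * s0 = (LINT s:{0<..}|lborel. q / 2 * indicator {0<..<s0} s)"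
  proof -
    have "(LINT s:{0<..}|lborel. q / 2 * indicator {0<..<s0} s) =
        (LINT s|lborel. q / 2 * indicator {0<..<s0} s)"
      unfolding set_lebesgue_integral_def
      by (intro Bochner_Integration.integral_cong) (auto simp: indicator_def)
    also have "\<dots> = q / 2 * s0" using s0(1) by simp
    finally show ?thesis by (rule sym)
  qed
  also have "\<dots> \<le> (LINT s:{0<..}|lborel. exp (- s\<^sup>2) * Q s)"
  proof (rule set_integral_mono[OF _ int])
    have "integrable lborel (\<lambda>s. q / 2 * indicator {0<..<s0} s)"
      by (intro integrable_mult_right integrable_real_indicator) (use s0(1) in auto)
    then show "set_integrable lborel {0<..} (\<lambda>s. q / 2 * indicator {0<..<s0} s)"
      unfolding set_integrable_def by (intro integrable_mult_indicator) auto
  next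
    fix s assume "s \<in> {0::real<..}"
    then show "q / 2 * indicator {0<..<s0} s \<le> exp (- s\<^sup>2) * Q s"
      using s0(2)[of s] Q_nonneg[of s] by (auto simp: indicator_def)
  qed
  finally have "0 < sqrt pi / 2 * (\<Sum>x\<in>S. \<Sum>y\<in>S. u x * u y * exp (- dist x y))"
    unfolding val using q s0(1) by (smt (verit) divide_pos_pos mult_pos_pos)
  then show ?thesis by (simp add: zero_less_mult_iff)
qed

section \<open>Solvability of positive definite systems and existence of weightings\<close>

text \<open>Gaussian elimination, one node at a time. Positivity is assumed for all finite sets
  because each induction step uses it on the set built so far, to see that the pivot is
  positive.\<close>

lemma pos_def_solvable:
  fixes k :: "'a \<Rightarrow> 'a \<Rightarrow> real"
  assumes "finite S" and sym: "\<And>x y. k x y = k y x"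
    and pd: "\<And>S u a. finite S \<Longrightarrow> a \<in> S \<Longrightarrow> u a \<noteq> 0 \<Longrightarrow> (\<Sum>x\<in>S. \<Sum>y\<in>S. u x * u y * k x y) > 0"
  shows "\<exists>w. \<forall>x\<in>S. (\<Sum>y\<in>S. k x y * w y) = b x"
  using assms(1)
proof (induction S arbitrary: b rule: finite_induct)
  case (insert a S)
  obtain z where z: "\<And>x. x \<in> S \<Longrightarrow> (\<Sum>y\<in>S. k x y * z y) = k x a"
    using insert.IH[of "\<lambda>x. k x a"] by auto
  obtain w0 where w0: "\<And>x. x \<in> S \<Longrightarrow> (\<Sum>y\<in>S. k x y * w0 y) = b x"
    using insert.IH[of b] by auto
  \<comment> \<open>The pivot is the value of the quadratic form at \<open>e\<^sub>a - z\<close>.\<close>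
  define p where "p = k a a - (\<Sum>y\<in>S. k a y * z y)"
  have neq: "y \<noteq> a" if "y \<in> S" for y using that insert.hyps by auto
  define u where "u = (\<lambda>x. if x = a then 1 else - z x)"
  have inner: "(\<Sum>y\<in>insert a S. u x * u y * k x y) = u x * (k x a - (\<Sum>y\<in>S. k x y * z y))" for x
  proof -
    have "(\<Sum>y\<in>S. u x * u y * k x y) = u x * - (\<Sum>y\<in>S. k x y * z y)"
      unfolding sum_negf[symmetric] sum_distrib_left
      by (intro sum.cong) (auto simp: u_def neq)
    then show ?thesis
      using insert.hyps by (simp add: u_def algebra_simps)
  qed
  have "(\<Sum>x\<in>insert a S. \<Sum>y\<in>insert a S. u x * u y * k x y) = p"
    unfolding inner using insert.hyps by (simp add: z p_def u_def)
  then have p: "p > 0"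
    using pd[of "insert a S" a u] insert.hyps by (simp add: u_def)
  \<comment> \<open>The correction by \<open>t\<close> at \<open>a\<close> and
    \<open>- t * z\<close> on \<open>S\<close> leaves the equations on \<open>S\<close> intact; this
    \<open>t\<close> fulfils the one at \<open>a\<close>.\<close>
  define t where "t = (b a - (\<Sum>y\<in>S. k a y * w0 y)) / p"
  define w where "w x = (if x = a then t else w0 x - t * z x)" for x
  have sumw: "(\<Sum>y\<in>insert a S. k x y * w y) =
      (\<Sum>y\<in>S. k x y * w0 y) + t * (k x a - (\<Sum>y\<in>S. k x y * z y))" for x
  proof -
    have "(\<Sum>y\<in>S. k x y * w y) = (\<Sum>y\<in>S. k x y * w0 y - t * (k x y * z y))"
      by (intro sum.cong) (auto simp: w_def neq algebra_simps)
    then show ?thesis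
      using insert.hyps by (simp add: w_def sum_subtractf sum_distrib_left algebra_simps)
  qed
  have "\<forall>x\<in>insert a S. (\<Sum>y\<in>insert a S. k x y * w y) = b x"
    unfolding sumw using p by (auto simp: z w0 t_def simp flip: p_def)
  then show ?case by blast
qed simp

lemma weighting_exists:
  fixes A :: "'a::euclidean_space set"
  assumes "finite A"
  obtains w where "weighting A w"
  using pos_def_solvable[OF assms, of "\<lambda>x y. exp (- dist x y)" "\<lambda>_. 1"] exp_dist_pos_def
  unfolding weighting_def by (auto simp: dist_commute)

section \<open>Energy inequalities for finite weights\<close>

definition potential :: "'a::metric_space set \<Rightarrow> ('a \<Rightarrow> real) \<Rightarrow> 'a \<Rightarrow> real" where
  "potential F v x = (\<Sum>y\<in>F. exp (- dist x y) * v y)"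

definition energy :: "'a::metric_space set \<Rightarrow> ('a \<Rightarrow> real) \<Rightarrow> real" where
  "energy F v = (\<Sum>x\<in>F. v x * potential F v x)"

text \<open>The expression is the energy of the difference of \<open>w\<close> and \<open>v\<close>,
  both extended by zero to \<open>A \<union> F\<close>. Positive definiteness applies on this common
  set.\<close>

lemma energy_diff_nonneg:
  fixes A F :: "'a::euclidean_space set"
  assumes "finite A" "finite F"
  shows "energy A w - 2 * (\<Sum>x\<in>A. w x * potential F v x) + energy F v \<ge> 0"
proof -
  define S where "S = A \<union> F"
  have S: "finite S" using assms by (simp add: S_def)
  define w' where "w' x = (if x \<in> A then w x else 0)" for x
  define v' where "v' x = (if x \<in> F then v x else 0)" for x
  let ?k = "\<lambda>x y :: 'a. exp (- dist x y)"
  have w': "(\<Sum>x\<in>S. w' x * f x) = (\<Sum>x\<in>A. w x * f x)" for f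
    by (rule sum.mono_neutral_cong_right) (use S in \<open>auto simp: w'_def S_def\<close>)
  have v': "(\<Sum>x\<in>S. v' x * f x) = (\<Sum>x\<in>F. v x * f x)" for f
    by (rule sum.mono_neutral_cong_right) (use S in \<open>auto simp: v'_def S_def\<close>)
  have quad: "0 \<le> (\<Sum>x\<in>S. \<Sum>y\<in>S. u x * u y * ?k x y)" for u
  proof (cases "\<forall>x\<in>S. u x = 0")
    case False
    then show ?thesis using exp_dist_pos_def[OF S] by (meson less_imp_le)
  qed simp
  have ww: "(\<Sum>x\<in>S. \<Sum>y\<in>S. w' x * w' y * ?k x y) = energy A w"
  proof -
    have "(\<Sum>x\<in>S. \<Sum>y\<in>S. w' x * w' y * ?k x y) = (\<Sum>x\<in>S. w' x * (\<Sum>y\<in>S. w' y * ?k x y))"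
      by (simp add: sum_distrib_left mult_ac)
    then show ?thesis unfolding w' energy_def potential_def by (simp add: mult_ac)
  qed
  have wv: "(\<Sum>x\<in>S. \<Sum>y\<in>S. w' x * v' y * ?k x y) = (\<Sum>x\<in>A. w x * potential F v x)"
  proof -
    have "(\<Sum>x\<in>S. \<Sum>y\<in>S. w' x * v' y * ?k x y) = (\<Sum>x\<in>S. w' x * (\<Sum>y\<in>S. v' y * ?k x y))"
      by (simp add: sum_distrib_left mult_ac)
    then show ?thesis unfolding w' v' potential_def by (simp add: mult_ac)
  qed
  have vv: "(\<Sum>x\<in>S. \<Sum>y\<in>S. v' x * v' y * ?k x y) = energy F v"
  proof -
    have "(\<Sum>x\<in>S. \<Sum>y\<in>S. v' x * v' y * ?k x y) = (\<Sum>x\<in>S. v' x * (\<Sum>y\<in>S. v' y * ?k x y))"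
      by (simp add: sum_distrib_left mult_ac)
    then show ?thesis unfolding v' energy_def potential_def by (simp add: mult_ac)
  qed
  have vw: "(\<Sum>x\<in>S. \<Sum>y\<in>S. v' x * w' y * ?k x y) = (\<Sum>x\<in>S. \<Sum>y\<in>S. w' x * v' y * ?k x y)"
    by (subst sum.swap) (simp add: dist_commute mult_ac)
  have "0 \<le> (\<Sum>x\<in>S. \<Sum>y\<in>S. (w' x - v' x) * (w' y - v' y) * ?k x y)"
    by (rule quad)
  also have "\<dots> = (\<Sum>x\<in>S. \<Sum>y\<in>S. w' x * w' y * ?k x y) - (\<Sum>x\<in>S. \<Sum>y\<in>S. w' x * v' y * ?k x y)
      - (\<Sum>x\<in>S. \<Sum>y\<in>S. v' x * w' y * ?k x y) + (\<Sum>x\<in>S. \<Sum>y\<in>S. v' x * v' y * ?k x y)"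
    unfolding sum_subtractf[symmetric] sum.distrib[symmetric]
    by (intro sum.cong refl) (simp add: algebra_simps)
  finally show ?thesis unfolding vw ww wv vv by simp
qed

lemma energy_weighting:
  assumes "weighting A w"
  shows "energy A w = finite_magnitude A"
  using assms by (simp add: energy_def potential_def weighting_def finite_magnitude_eq)

text \<open>In \<open>energy_diff_nonneg\<close> the energy of \<open>w\<close> is the magnitude of
  \<open>A\<close>, and the cross term is almost its double. As \<open>w\<close> has no sign, the
  error involves the sum of its absolute values. This sum depends on \<open>A\<close> only, so
  \<open>d\<close> can be chosen afterwards.\<close>

lemma finite_magnitude_le:
  fixes A F :: "'a::euclidean_space set"
  assumes "finite A" "finite F" "weighting A w"
    and pot: "\<And>x. x \<in> A \<Longrightarrow> \<bar>potential F v x - 1\<bar> \<le> d"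
  shows "finite_magnitude A \<le> energy F v + 2 * d * (\<Sum>x\<in>A. \<bar>w x\<bar>)"
proof -
  have "(\<Sum>x\<in>A. w x) - (\<Sum>x\<in>A. w x * potential F v x) = (\<Sum>x\<in>A. w x * (1 - potential F v x))"
    by (simp add: algebra_simps sum_subtractf)
  also have "\<dots> \<le> (\<Sum>x\<in>A. d * \<bar>w x\<bar>)"
  proof (rule sum_mono)
    fix x assume "x \<in> A"
    have "w x * (1 - potential F v x) \<le> \<bar>w x\<bar> * \<bar>potential F v x - 1\<bar>"
      by (metis abs_ge_self abs_minus_commute abs_mult)
    also have "\<dots> \<le> \<bar>w x\<bar> * d" using pot[OF \<open>x \<in> A\<close>] by (intro mult_left_mono) auto
    finally show "w x * (1 - potential F v x) \<le> d * \<bar>w x\<bar>" by (simp add: mult.commute)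
  qed
  finally show ?thesis
    using energy_diff_nonneg[OF assms(1,2), of w v] energy_weighting[OF assms(3)]
      finite_magnitude_eq[OF assms(3)] by (simp flip: sum_distrib_left)
qed

lemma finite_magnitude_ge:
  fixes F :: "'a::euclidean_space set"
  assumes "finite F"
  shows "finite_magnitude F \<ge> 2 * (\<Sum>x\<in>F. v x) - energy F v"
proof -
  obtain w where w: "weighting F w" using weighting_exists[OF assms] .
  \<comment> \<open>By symmetry, pairing \<open>w\<close> with the potential of \<open>v\<close>
    equals pairing \<open>v\<close> with the potential of \<open>w\<close>, which is 1 on
    \<open>F\<close>.\<close>
  have "(\<Sum>x\<in>F. w x * potential F v x) = (\<Sum>x\<in>F. \<Sum>y\<in>F. v y * (exp (- dist y x) * w x))"
    by (simp add: potential_def sum_distrib_left dist_commute mult_ac)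
  also have "\<dots> = (\<Sum>y\<in>F. v y * (\<Sum>x\<in>F. exp (- dist y x) * w x))"
    by (subst sum.swap) (simp add: sum_distrib_left)
  also have "\<dots> = (\<Sum>x\<in>F. v x)" using w by (simp add: weighting_def)
  finally show ?thesis
    using energy_diff_nonneg[OF assms assms, of w v] energy_weighting[OF w] by simp
qed

section \<open>Discretisation of integrable densities\<close>

lemma exp_dist_diff_le:
  fixes x x' y :: "'a::metric_space"
  shows "\<bar>exp (- dist x y) - exp (- dist x' y)\<bar> \<le> dist x x'"
proof -
  have *: "exp (- a) - exp (- b) \<le> b - a" if "0 \<le> a" "a \<le> b" for a b :: real
  proof -
    have "exp (- a) - exp (- b) = exp (- a) * (1 - exp (- (b - a)))"
      by (simp add: algebra_simps flip: exp_add)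
    also have "\<dots> \<le> 1 * (1 - exp (- (b - a)))"
      using that by (intro mult_right_mono) auto
    also have "\<dots> \<le> b - a" using exp_ge_add_one_self[of "- (b - a)"] unfolding mult_1 by linarith
    finally show ?thesis .
  qed
  have "\<bar>dist x y - dist x' y\<bar> \<le> dist x x'"
    using dist_triangle[of x y x'] dist_triangle[of x' y x] by (simp add: dist_commute abs_le_iff)
  then show ?thesis
    using *[of "dist x y" "dist x' y"] *[of "dist x' y" "dist x y"]
    by (cases "dist x y \<le> dist x' y") (auto simp: abs_le_iff)
qed

lemma integrable_exp_dist:
  fixes g :: "'a::euclidean_space \<Rightarrow> real"
  assumes "integrable lborel g"
  shows "integrable lborel (\<lambda>y. g y * exp (- dist x y))"
  using assms
proof (rule Bochner_Integration.integrable_bound)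
  have "g \<in> borel_measurable borel" using assms by auto
  moreover have "(\<lambda>y. exp (- dist x y)) \<in> borel_measurable borel"
    by (intro borel_measurable_continuous_onI continuous_intros)
  ultimately show "(\<lambda>y. g y * exp (- dist x y)) \<in> borel_measurable lborel" by simp
qed (auto simp: abs_mult mult_left_le)

text \<open>Serves three purposes: measurability of potentials, control of the discretisation error,
  and passage to the centre of the ball.\<close>

lemma potential_integral_lipschitz:
  fixes g :: "'a::euclidean_space \<Rightarrow> real"
  assumes g: "integrable lborel g"
  shows "\<bar>(LINT y|lborel. g y * exp (- dist x y)) - (LINT y|lborel. g y * exp (- dist x' y))\<bar>
    \<le> dist x x' * (LINT y|lborel. \<bar>g y\<bar>)"
proof -
  note i = integrable_exp_dist[OF g]
  have "\<bar>(LINT y|lborel. g y * exp (- dist x y)) - (LINT y|lborel. g y * exp (- dist x' y))\<bar> =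
      \<bar>LINT y|lborel. g y * (exp (- dist x y) - exp (- dist x' y))\<bar>"
    using i by (simp add: algebra_simps)
  also have "\<dots> \<le> (LINT y|lborel. \<bar>g y * (exp (- dist x y) - exp (- dist x' y))\<bar>)"
    by (rule integral_abs_bound)
  also have "\<dots> \<le> (LINT y|lborel. dist x x' * \<bar>g y\<bar>)"
  proof (rule integral_mono)
    show "integrable lborel (\<lambda>y. \<bar>g y * (exp (- dist x y) - exp (- dist x' y))\<bar>)"
      using i by (intro integrable_abs) (simp add: algebra_simps)
    show "integrable lborel (\<lambda>y. dist x x' * \<bar>g y\<bar>)"
      using g by auto
    show "\<bar>g y * (exp (- dist x y) - exp (- dist x' y))\<bar> \<le> dist x x' * \<bar>g y\<bar>" for y
      using mult_left_mono[OF exp_dist_diff_le[of x y x'] abs_ge_zero[of "g y"]]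
      by (simp add: abs_mult mult.commute)
  qed
  finally show ?thesis by simp
qed

text \<open>Going to the first point of an enumerated net that is close enough makes the rounding
  map measurable, so that densities can be pushed forward along it.\<close>

lemma finite_rounding:
  fixes X :: "'a::euclidean_space set"
  assumes "compact X" "d > 0"
  obtains F r where "finite F" "F \<subseteq> X" "r \<in> borel_measurable borel"
    "\<And>x. x \<in> X \<Longrightarrow> r x \<in> F \<and> dist x (r x) \<le> d"
proof (cases "X = {}")
  case True
  then show ?thesis using that[of "{}" id] by auto
next
  case False
  obtain F where F: "F \<subseteq> X" "finite F" "X \<subseteq> (\<Union>y\<in>F. ball y d)"
  proof (rule compactE_image[OF assms(1), of X "\<lambda>y. ball y d"])
    show "X \<subseteq> (\<Union>y\<in>X. ball y d)" using assms(2) by force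
  qed auto
  then have "F \<noteq> {}" using False by auto
  then obtain n :: nat and k where k: "F = k ` {i. i < n}"
    using F(2) by (metis finite_imp_nat_seg_image_inj_on)
  \<comment> \<open>Indices from \<open>n\<close> on always qualify, so the least index exists even
    at points that the net misses; on \<open>X\<close> it is below \<open>n\<close>.\<close>
  define P where "P x i \<longleftrightarrow> i < n \<and> dist x (k i) < d \<or> i \<ge> n" for x i
  define r where "r x = k (LEAST i. P x i)" for x
  have "r \<in> borel_measurable borel"
  proof -
    have "(\<lambda>x. LEAST i. P x i) \<in> borel \<rightarrow>\<^sub>M count_space UNIV"
      unfolding P_def by measurable
    then show ?thesis
      unfolding r_def by (rule measurable_compose) auto
  qed
  moreover have "r x \<in> F \<and> dist x (r x) \<le> d" if x: "x \<in> X" for x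
  proof -
    obtain i where i: "i < n" "dist x (k i) < d"
    proof -
      obtain y where "y \<in> F" "dist x y < d" using F(3) x by (auto simp: dist_commute)
      then show thesis using that k by blast
    qed
    define j where "j = (LEAST i. P x i)"
    have "P x i" using i by (simp add: P_def)
    then have "P x j" "j \<le> i" unfolding j_def by (auto intro: LeastI Least_le)
    moreover have "r x = k j" by (simp add: r_def j_def)
    ultimately show ?thesis using i k by (auto simp: P_def)
  qed
  ultimately show ?thesis using that[of F r] F by auto
qed

text \<open>\<open>v\<close> is the image of the measure with density \<open>g\<close> under
  rounding to a fine net in \<open>X\<close>. Its mass is exact. The Lipschitz property of the
  kernel controls the potential, and once more, applied to the potential itself, the energy.\<close>

lemma finite_approximation:
  fixes g :: "'a::euclidean_space \<Rightarrow> real" and X :: "'a set"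
  defines "P \<equiv> \<lambda>x. LINT y|lborel. g y * exp (- dist x y)"
  assumes g: "integrable lborel g" and X: "compact X" and supp: "\<And>x. x \<notin> X \<Longrightarrow> g x = 0"
    and d: "d > 0"
  obtains F v where "finite F" "F \<subseteq> X" "(\<Sum>x\<in>F. v x) = (LINT x|lborel. g x)"
    "\<And>x. \<bar>potential F v x - P x\<bar> \<le> d" "\<bar>energy F v - (LINT x|lborel. g x * P x)\<bar> \<le> d"
proof -
  define N where "N = (LINT x|lborel. \<bar>g x\<bar>)"
  have N: "N \<ge> 0" unfolding N_def by simp
  \<comment> \<open>The errors below are \<open>e * N\<close> for the potential and
    \<open>2 * e * N * N\<close> for the energy; the summand 1 keeps the denominator
    positive.\<close>
  define e where "e = d / (1 + N + 2 * N * N)"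
  have den: "1 + N + 2 * N * N > 0" using N by (simp add: add_pos_nonneg)
  have e: "e > 0" using d den by (simp add: e_def)
  have eN: "e * N \<le> d" "2 * e * N * N \<le> d"
    using den d N by (simp_all add: e_def field_simps mult_left_mono)
  obtain F r where F: "finite F" "F \<subseteq> X" and [measurable]: "r \<in> borel_measurable borel"
    and r: "\<And>x. x \<in> X \<Longrightarrow> r x \<in> F \<and> dist x (r x) \<le> e"
    using finite_rounding[OF X e] by metis
  have [measurable]: "g \<in> borel_measurable lborel" using g by auto
  define v where "v y = (LINT x|lborel. g x * indicator (r -` {y}) x)" for y
  have gi: "integrable lborel (\<lambda>x. g x * indicator (r -` {y}) x)" for y
  proof -
    have "r -` {y} \<in> sets lborel"
      using measurable_sets[of r borel borel "{y}"] by simp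
    then show ?thesis using g by (rule integrable_real_mult_indicator)
  qed
  \<comment> \<open>For \<open>x \<in> X\<close> exactly one summand survives. Outside
    \<open>X\<close> nothing is known about \<open>r\<close>, but there \<open>g\<close>
    vanishes.\<close>
  have rnd: "(\<Sum>y\<in>F. g x * indicator (r -` {y}) x * h y) = g x * h (r x)" for x h
  proof (cases "x \<in> X")
    case True
    have "(\<Sum>y\<in>F. g x * indicator (r -` {y}) x * h y) = (\<Sum>y\<in>F. if r x = y then g x * h y else 0)"
      by (intro sum.cong) (auto simp: indicator_def)
    then show ?thesis using F r[OF True] by simp
  qed (simp add: supp)
  have sum_v: "(\<Sum>y\<in>F. v y * h y) = (LINT x|lborel. g x * h (r x))" for h
  proof -
    have "(\<Sum>y\<in>F. v y * h y) = (LINT x|lborel. (\<Sum>y\<in>F. g x * indicator (r -` {y}) x * h y))"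
      unfolding v_def using gi by (subst Bochner_Integration.integral_sum) auto
    then show ?thesis unfolding rnd .
  qed
  have int_r: "integrable lborel (\<lambda>x. g x * h (r x))" for h
  proof -
    have "integrable lborel (\<lambda>x. \<Sum>y\<in>F. g x * indicator (r -` {y}) x * h y)"
      using gi by (intro Bochner_Integration.integrable_sum integrable_mult_left) auto
    then show ?thesis unfolding rnd .
  qed
  have total: "(\<Sum>x\<in>F. v x) = (LINT x|lborel. g x)"
    using sum_v[of "\<lambda>_. 1"] by simp
  have bound: "\<bar>(LINT x|lborel. g x * h1 x) - (LINT x|lborel. g x * h2 x)\<bar> \<le> c * N"
    if "integrable lborel (\<lambda>x. g x * h1 x)" "integrable lborel (\<lambda>x. g x * h2 x)"
      "\<And>x. x \<in> X \<Longrightarrow> \<bar>h1 x - h2 x\<bar> \<le> c" for h1 h2 c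
  proof -
    have "\<bar>(LINT x|lborel. g x * h1 x) - (LINT x|lborel. g x * h2 x)\<bar> =
        \<bar>LINT x|lborel. g x * h1 x - g x * h2 x\<bar>" using that by simp
    also have "\<dots> \<le> (LINT x|lborel. \<bar>g x * h1 x - g x * h2 x\<bar>)" by (rule integral_abs_bound)
    also have "\<dots> \<le> (LINT x|lborel. c * \<bar>g x\<bar>)"
    proof (rule integral_mono)
      show "\<bar>g x * h1 x - g x * h2 x\<bar> \<le> c * \<bar>g x\<bar>" for x
      proof (cases "x \<in> X")
        case True
        then show ?thesis using mult_left_mono[OF that(3)[OF True] abs_ge_zero[of "g x"]]
          by (simp add: mult.commute flip: abs_mult right_diff_distrib)
      qed (simp add: supp)
    qed (use that g in auto)
    finally show ?thesis by (simp add: N_def)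
  qed
  have pot_eq: "potential F v x = (LINT y|lborel. g y * exp (- dist x (r y)))" for x
    using sum_v[of "\<lambda>y. exp (- dist x y)"] by (simp add: potential_def mult.commute)
  have pot: "\<bar>potential F v x - P x\<bar> \<le> e * N" for x
    unfolding pot_eq P_def
  proof (rule bound)
    fix y assume "y \<in> X"
    then show "\<bar>exp (- dist x (r y)) - exp (- dist x y)\<bar> \<le> e"
      using exp_dist_diff_le[of "r y" x y] r[of y] by (simp add: dist_commute)
  qed (use integrable_exp_dist[OF g] int_r in auto)
  have lip: "\<bar>P x - P y\<bar> \<le> dist x y * N" for x y
    unfolding P_def N_def by (rule potential_integral_lipschitz[OF g])
  have P_meas [measurable]: "P \<in> borel_measurable borel"
  proof (rule borel_measurable_continuous_onI)
    have "N-lipschitz_on UNIV P"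
      using lip N by (intro lipschitz_onI) (auto simp: dist_real_def mult.commute)
    then show "continuous_on UNIV P" by (rule lipschitz_on_continuous_on)
  qed
  have P_bound: "\<bar>P x\<bar> \<le> N" for x
    using bound[of "\<lambda>y. exp (- dist x y)" "\<lambda>_. 0" 1] integrable_exp_dist[OF g] by (simp add: P_def)
  have int_P: "integrable lborel (\<lambda>x. g x * P x)"
  proof (rule Bochner_Integration.integrable_bound)
    show "integrable lborel (\<lambda>x. g x * N)" using g by auto
    show "AE x in lborel. norm (g x * P x) \<le> norm (g x * N)"
      using P_bound N by (auto simp: abs_mult intro!: mult_left_mono)
  qed measurable
  have "\<bar>energy F v - (LINT x|lborel. g x * P x)\<bar> \<le> (2 * e * N) * N"
    unfolding energy_def sum_v
  proof (rule bound)
    fix x assume "x \<in> X"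
    have "\<bar>potential F v (r x) - P x\<bar> \<le> \<bar>potential F v (r x) - P (r x)\<bar> + \<bar>P x - P (r x)\<bar>" by linarith
    also have "\<dots> \<le> e * N + dist x (r x) * N" by (intro add_mono pot lip)
    also have "\<dots> \<le> e * N + e * N" using r[OF \<open>x \<in> X\<close>] N by (intro add_mono mult_right_mono) auto
    finally show "\<bar>potential F v (r x) - P x\<bar> \<le> 2 * e * N" by (simp add: mult_ac)
  qed (use int_r int_P in auto)
  then have "\<bar>energy F v - (LINT x|lborel. g x * P x)\<bar> \<le> d" using eN by linarith
  moreover have "\<bar>potential F v x - P x\<bar> \<le> d" for x using pot[of x] eN by linarith
  ultimately show ?thesis using that[OF F total] by blast
qed

section \<open>Potential of a five-dimensional ball\<close>

text \<open>Radius 0 is included because a slice may touch the sphere in a single point. Its measure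
  is bounded by the volumes for small positive radii.\<close>

lemma emeasure_cball_product:
  assumes "finite A" "A \<noteq> {}" "r \<ge> 0"
  shows "emeasure (Pi\<^sub>M A (\<lambda>_. lborel))
      ({f. sqrt (\<Sum>i\<in>A. (f i)\<^sup>2) \<le> r} \<inter> space (Pi\<^sub>M A (\<lambda>_. lborel))) =
    ennreal (unit_ball_vol (real (card A)) * r ^ card A)"
proof (cases "r = 0")
  case False
  then show ?thesis using assms by (intro emeasure_cball_aux) auto
next
  case True
  let ?M = "Pi\<^sub>M A (\<lambda>_. lborel :: real measure)"
  let ?B = "\<lambda>r. {f. sqrt (\<Sum>i\<in>A. (f i)\<^sup>2) \<le> r} \<inter> space ?M"
  let ?v = "\<lambda>r. unit_ball_vol (real (card A)) * r ^ card A"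
  have "((\<lambda>r. ennreal (?v r)) \<longlongrightarrow> ennreal (?v 0)) (at_right 0)"
    by (intro tendsto_intros)
  moreover have "\<forall>\<^sub>F r in at_right 0. emeasure ?M (?B 0) \<le> ennreal (?v r)"
    using eventually_at_right_less[of "0::real"]
  proof eventually_elim
    case (elim r)
    have "(\<lambda>f. sqrt (\<Sum>i\<in>A. (f i)\<^sup>2)) \<in> borel_measurable ?M" by measurable
    then have "?B r \<in> sets ?M" by (simp add: borel_measurable_iff_le Int_def conj_commute)
    then have "emeasure ?M (?B 0) \<le> emeasure ?M (?B r)"
      using elim by (intro emeasure_mono) (auto simp del: real_sqrt_le_0_iff)
    also have "\<dots> = ennreal (?v r)" using elim assms by (intro emeasure_cball_aux) auto
    finally show ?case .
  qed
  ultimately have "emeasure ?M (?B 0) \<le> ennreal (?v 0)"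
    by (rule tendsto_lowerbound) simp
  moreover have "?v 0 = 0" using assms by (simp add: card_gt_0_iff)
  ultimately show ?thesis using True by simp
qed

text \<open>On the half-line up to \<open>a\<close> the left measure is the volume of a
  four-dimensional ball with squared radius \<open>a\<^sup>2 - t\<^sup>2\<close>, that is
  \<open>pi\<^sup>2 / 2 * (a\<^sup>2 - t\<^sup>2)\<^sup>2\<close>. The density is its derivative in
  \<open>a\<close>, and half-lines determine the measure.\<close>

lemma distr_norm_slice:
  fixes t :: real
  assumes "finite A" "card A = 4"
  shows "distr (Pi\<^sub>M A (\<lambda>_. lborel)) borel (\<lambda>f. sqrt (t\<^sup>2 + (\<Sum>i\<in>A. (f i)\<^sup>2))) =
    density lborel (\<lambda>r. ennreal (2 * pi\<^sup>2 * r * (r\<^sup>2 - t\<^sup>2)) * indicator {\<bar>t\<bar>..} r)"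
    (is "?L = ?R")
proof (rule measure_eqI_generator_eq)
  let ?M = "Pi\<^sub>M A (\<lambda>_. lborel :: real measure)"
  let ?E = "range (\<lambda>a::real. {..a})"
  have val: "emeasure ?L {..a} = (if a < \<bar>t\<bar> then 0 else ennreal (pi\<^sup>2 / 2 * (a\<^sup>2 - t\<^sup>2)\<^sup>2))" for a
  proof -
    have "emeasure ?L {..a} =
        emeasure ?M ({f. sqrt (t\<^sup>2 + (\<Sum>i\<in>A. (f i)\<^sup>2)) \<le> a} \<inter> space ?M)"
      by (subst emeasure_distr) (auto simp: vimage_def)
    also have "\<dots> = (if a < \<bar>t\<bar> then 0 else ennreal (pi\<^sup>2 / 2 * (a\<^sup>2 - t\<^sup>2)\<^sup>2))"
    proof (cases "a < \<bar>t\<bar>")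
      case True
      have "\<not> sqrt (t\<^sup>2 + (\<Sum>i\<in>A. (f i)\<^sup>2)) \<le> a" for f :: "_ \<Rightarrow> real"
      proof -
        have "\<bar>t\<bar> \<le> sqrt (t\<^sup>2 + (\<Sum>i\<in>A. (f i)\<^sup>2))"
          by (rule real_le_rsqrt) (simp add: sum_nonneg)
        then show ?thesis using True by linarith
      qed
      then show ?thesis using True by simp
    next
      case False
      then have at: "t\<^sup>2 \<le> a\<^sup>2" "a \<ge> 0" by (auto simp: abs_le_square_iff[symmetric])
      have "sqrt (t\<^sup>2 + c) \<le> a \<longleftrightarrow> sqrt c \<le> sqrt (a\<^sup>2 - t\<^sup>2)" if "c \<ge> 0" for c
        using that at by (simp add: real_sqrt_le_iff') linarith
      then have "{f. sqrt (t\<^sup>2 + (\<Sum>i\<in>A. (f i)\<^sup>2)) \<le> a} \<inter> space ?M =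
          {f. sqrt (\<Sum>i\<in>A. (f i)\<^sup>2) \<le> sqrt (a\<^sup>2 - t\<^sup>2)} \<inter> space ?M"
        by (simp add: sum_nonneg)
      also have "emeasure ?M \<dots> = ennreal (unit_ball_vol (real (card A)) * sqrt (a\<^sup>2 - t\<^sup>2) ^ card A)"
        using assms at by (intro emeasure_cball_product) auto
      also have "unit_ball_vol (real (card A)) * sqrt (a\<^sup>2 - t\<^sup>2) ^ card A = pi\<^sup>2 / 2 * (a\<^sup>2 - t\<^sup>2)\<^sup>2"
      proof -
        have "sqrt (a\<^sup>2 - t\<^sup>2) ^ 4 = (sqrt (a\<^sup>2 - t\<^sup>2) ^ 2) ^ 2" by simp
        also have "\<dots> = (a\<^sup>2 - t\<^sup>2)\<^sup>2" using at by (subst real_sqrt_pow2) auto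
        finally show ?thesis by (simp add: assms eval_unit_ball_vol)
      qed
      finally show ?thesis using False by simp
    qed
    finally show ?thesis .
  qed
  show "emeasure ?L X = emeasure ?R X" if E: "X \<in> ?E" for X
  proof -
    obtain a where X: "X = {..a}" using E by auto
    have "emeasure ?R {..a} = (\<integral>\<^sup>+r. ennreal (2 * pi\<^sup>2 * r * (r\<^sup>2 - t\<^sup>2)) * indicator {\<bar>t\<bar>..a} r \<partial>lborel)"
      by (subst emeasure_density) (auto intro!: nn_integral_cong simp: indicator_def)
    also have "\<dots> = (if a < \<bar>t\<bar> then 0 else ennreal (pi\<^sup>2 / 2 * (a\<^sup>2 - t\<^sup>2)\<^sup>2))"
    proof (cases "a < \<bar>t\<bar>")
      case False
      have "(\<integral>\<^sup>+r. ennreal (2 * pi\<^sup>2 * r * (r\<^sup>2 - t\<^sup>2)) * indicator {\<bar>t\<bar>..a} r \<partial>lborel) =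
          ennreal (pi\<^sup>2 / 2 * (a\<^sup>2 - t\<^sup>2)\<^sup>2 - pi\<^sup>2 / 2 * (\<bar>t\<bar>\<^sup>2 - t\<^sup>2)\<^sup>2)"
      proof (rule nn_integral_FTC_Icc)
        fix r assume "r \<in> {\<bar>t\<bar>..a}"
        then have "t\<^sup>2 \<le> r\<^sup>2" "r \<ge> 0" by (auto simp: abs_le_square_iff[symmetric])
        then show "0 \<le> 2 * pi\<^sup>2 * r * (r\<^sup>2 - t\<^sup>2)" by simp
        show "((\<lambda>r. pi\<^sup>2 / 2 * (r\<^sup>2 - t\<^sup>2)\<^sup>2) has_real_derivative 2 * pi\<^sup>2 * r * (r\<^sup>2 - t\<^sup>2)) (at r)"
          by (auto intro!: derivative_eq_intros simp: algebra_simps power2_eq_square)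
      qed (use False in auto)
      then show ?thesis using False by simp
    qed simp
    finally show ?thesis using val X by simp
  qed
  show "Int_stable ?E"
  proof (rule Int_stableI)
    fix a b assume "a \<in> ?E" "b \<in> ?E"
    then obtain x y :: real where "a = {..x}" "b = {..y}" by auto
    then have "a \<inter> b = {..min x y}" by auto
    then show "a \<inter> b \<in> ?E" by blast
  qed
  show "range (\<lambda>i::nat. {..real i}) \<subseteq> ?E" by auto
  show "(\<Union>i. {..real i}) = UNIV" by (auto intro: real_arch_simple)
  show "emeasure ?L {..real i} \<noteq> \<infinity>" for i unfolding val by simp
  show "?E \<subseteq> Pow UNIV" by simp
  have "sets (borel :: real measure) = sigma_sets UNIV ?E"
    by (subst borel_eq_atMost) simp
  then show "sets ?L = sigma_sets UNIV ?E" "sets ?R = sigma_sets UNIV ?E" by simp_all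
qed

text \<open>The density \<open>2 \<pi>\<^sup>2 r (r\<^sup>2 - t\<^sup>2)\<close> comes from the four-dimensional slice at coordinate \<open>t\<close>.\<close>

lemma nn_integral_norm_coordinate:
  fixes b :: "'a::euclidean_space" and F :: "real \<times> real \<Rightarrow> ennreal"
  assumes dim: "DIM('a) = 5" and b: "b \<in> Basis" and [measurable]: "F \<in> borel_measurable borel"
  shows "(\<integral>\<^sup>+z. F (norm z, z \<bullet> b) \<partial>lborel) =
    (\<integral>\<^sup>+t. \<integral>\<^sup>+r. ennreal (2 * pi\<^sup>2 * r * (r\<^sup>2 - t\<^sup>2)) * indicator {\<bar>t\<bar>..} r * F (r, t) \<partial>lborel \<partial>lborel)"
proof -
  interpret product_sigma_finite "\<lambda>_::'a. lborel :: real measure" by standard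
  let ?B = "Basis - {b}"
  have B: "(Basis :: 'a set) = insert b ?B" "finite ?B" "card ?B = 4"
    using b dim by auto
  have [measurable]: "F \<in> borel_measurable (borel \<Otimes>\<^sub>M borel)" by (simp add: borel_prod)
  let ?h = "\<lambda>f :: 'a \<Rightarrow> real. F (sqrt (\<Sum>c\<in>Basis. (f c)\<^sup>2), f b)"
  have comp: "(\<lambda>f. f c) \<in> borel_measurable (\<Pi>\<^sub>M c\<in>Basis. lborel)" if "c \<in> Basis" for c :: 'a
    using measurable_component_singleton[OF that, of "\<lambda>_. lborel"] unfolding measurable_lborel1 .
  have h_meas: "?h \<in> borel_measurable (\<Pi>\<^sub>M c\<in>Basis. lborel)"
  proof -
    have "(\<lambda>f. \<Sum>c\<in>Basis. (f c)\<^sup>2) \<in> borel_measurable (\<Pi>\<^sub>M c\<in>(Basis :: 'a set). lborel :: real measure)"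
      by (intro borel_measurable_sum borel_measurable_power comp)
    then have "(\<lambda>f. sqrt (\<Sum>c\<in>Basis. (f c)\<^sup>2)) \<in> borel_measurable (\<Pi>\<^sub>M c\<in>(Basis :: 'a set). lborel :: real measure)"
      by (rule measurable_compose) measurable
    then show ?thesis
      by (intro measurable_compose[OF _ assms(3)] borel_measurable_Pair comp b)
  qed
  have norm_sum: "norm (\<Sum>c\<in>Basis. f c *\<^sub>R c) = sqrt (\<Sum>c\<in>Basis. (f c)\<^sup>2)" for f :: "'a \<Rightarrow> real"
    unfolding norm_eq_sqrt_inner by (subst euclidean_inner) (simp add: power2_eq_square)
  have "(\<integral>\<^sup>+z. F (norm z, z \<bullet> b) \<partial>lborel) = (\<integral>\<^sup>+f. ?h f \<partial>(\<Pi>\<^sub>M c\<in>Basis. lborel))"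
    using b by (subst lborel_eq, subst nn_integral_distr) (simp_all add: norm_sum)
  also have "\<dots> = (\<integral>\<^sup>+t. \<integral>\<^sup>+f. ?h (f(b := t)) \<partial>(\<Pi>\<^sub>M c\<in>?B. lborel) \<partial>lborel)"
    by (rule product_nn_integral_insert_rev[of ?B b ?h, unfolded B(1)[symmetric]]) (use h_meas in auto)
  also have "\<dots> = (\<integral>\<^sup>+t. \<integral>\<^sup>+f. F (sqrt (t\<^sup>2 + (\<Sum>c\<in>?B. (f c)\<^sup>2)), t) \<partial>(\<Pi>\<^sub>M c\<in>?B. lborel) \<partial>lborel)"
  proof (intro nn_integral_cong)
    fix t and f :: "'a \<Rightarrow> real"
    have "(\<Sum>c\<in>Basis. ((f(b := t)) c)\<^sup>2) = t\<^sup>2 + (\<Sum>c\<in>?B. (f c)\<^sup>2)"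
      using b by (subst sum.remove[of _ b]) auto
    then show "?h (f(b := t)) = F (sqrt (t\<^sup>2 + (\<Sum>c\<in>?B. (f c)\<^sup>2)), t)" by simp
  qed
  also have "\<dots> = (\<integral>\<^sup>+t. \<integral>\<^sup>+r. F (r, t)
      \<partial>distr (\<Pi>\<^sub>M c\<in>?B. lborel) borel (\<lambda>f. sqrt (t\<^sup>2 + (\<Sum>c\<in>?B. (f c)\<^sup>2))) \<partial>lborel)"
    by (intro nn_integral_cong, subst nn_integral_distr) auto
  also have "\<dots> = (\<integral>\<^sup>+t. \<integral>\<^sup>+r. ennreal (2 * pi\<^sup>2 * r * (r\<^sup>2 - t\<^sup>2)) * indicator {\<bar>t\<bar>..} r * F (r, t)
      \<partial>lborel \<partial>lborel)"
    unfolding distr_norm_slice[OF B(2,3)]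
    by (intro nn_integral_cong, subst nn_integral_density) auto
  finally show ?thesis .
qed

lemma lborel_orthogonal_transformation:
  fixes T :: "real ^ 'n::{finite,wellorder} \<Rightarrow> real ^ 'n::_"
  assumes T: "orthogonal_transformation T"
  shows "distr lborel borel T = lborel"
proof (rule lborel_eqI[symmetric])
  have [measurable]: "T \<in> borel_measurable borel"
    using orthogonal_transformation_linear[OF T]
    by (intro borel_measurable_continuous_onI linear_continuous_on linear_conv_bounded_linear[THEN iffD1])
  fix l u :: "real ^ 'n::_"
  assume lu: "\<And>b. b \<in> Basis \<Longrightarrow> l \<bullet> b \<le> u \<bullet> b"
  have inv: "orthogonal_transformation (inv T)" using T by (rule orthogonal_transformation_inv)
  have "T -` box l u = inv T ` box l u"
    using orthogonal_transformation_bij[OF T] by (simp add: bij_vimage_eq_inv_image)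
  then have "emeasure (distr lborel borel T) (box l u) = emeasure lborel (inv T ` box l u)"
    by (simp add: emeasure_distr)
  also have "\<dots> = emeasure lebesgue (inv T ` box l u)"
  proof -
    have "T -` box l u \<in> sets borel"
      using measurable_sets[of T borel borel "box l u"] by simp
    then have "inv T ` box l u \<in> sets lborel" using \<open>T -` box l u = inv T ` box l u\<close> by simp
    then show ?thesis by simp
  qed
  also have "\<dots> = ennreal (measure lebesgue (inv T ` box l u))"
    using measurable_orthogonal_image[OF inv lmeasurable_box] by (simp add: emeasure_eq_measure2 fmeasurableD2)
  also have "\<dots> = ennreal (measure lebesgue (box l u))"
    by (simp add: measure_orthogonal_image[OF inv])
  also have "\<dots> = ennreal (\<Prod>b\<in>Basis. (u - l) \<bullet> b)"
    using lu by (simp add: measure_lborel_box_eq)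
  finally show "emeasure (distr lborel borel T) (box l u) = ennreal (\<Prod>b\<in>Basis. (u - l) \<bullet> b)" .
qed simp

text \<open>\<open>cap_slice r t\<close> is the integral of \<open>r\<^sup>2 - u\<^sup>2\<close> over \<open>- r \<le> u \<le> t\<close>.\<close>

definition cap_slice :: "real \<Rightarrow> real \<Rightarrow> real" where
  "cap_slice r t = r\<^sup>2 * t - t ^ 3 / 3 + 2 * r ^ 3 / 3"

text \<open>Let \<open>p\<close> be the distance of a point from the centre of a ball of radius \<open>s\<close>. The sphere of radius
  \<open>r\<close> about the point meets the ball in a set of area \<open>lens p s r * exp r\<close> if it crosses the
  boundary, and of area \<open>shell r * exp r\<close> if it lies inside.\<close>

definition lens :: "real \<Rightarrow> real \<Rightarrow> real \<Rightarrow> real" where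
  "lens p s r = 2 * pi\<^sup>2 * r * exp (- r) * cap_slice r ((s\<^sup>2 - p\<^sup>2 - r\<^sup>2) / (2 * p))"

definition shell :: "real \<Rightarrow> real" where
  "shell r = 8 * pi\<^sup>2 / 3 * r ^ 4 * exp (- r)"

text \<open>The sum of all derivatives in \<open>r\<close> of the polynomial \<open>24 p\<^sup>3 r * cap_slice r ((s\<^sup>2 - p\<^sup>2 - r\<^sup>2) / (2 p))\<close>.\<close>

definition lens_poly :: "real \<Rightarrow> real \<Rightarrow> real \<Rightarrow> real" where
  "lens_poly p s r = r ^ 7 + 7 * r ^ 6 + (42 - 3 * s ^ 2 - 9 * p ^ 2) * r ^ 5
    + (210 - 15 * s ^ 2 - 45 * p ^ 2 + 16 * p ^ 3) * r ^ 4
    + (840 - 60 * s ^ 2 + 3 * s ^ 4 - 180 * p ^ 2 + 6 * p ^ 2 * s ^ 2 + 64 * p ^ 3 - 9 * p ^ 4) * r ^ 3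
    + (2520 - 180 * s ^ 2 + 9 * s ^ 4 - 540 * p ^ 2 + 18 * p ^ 2 * s ^ 2 + 192 * p ^ 3 - 27 * p ^ 4) * r ^ 2
    + (5040 - 360 * s ^ 2 + 18 * s ^ 4 - s ^ 6 - 1080 * p ^ 2 + 36 * p ^ 2 * s ^ 2 + 3 * p ^ 2 * s ^ 4
       + 384 * p ^ 3 - 54 * p ^ 4 - 3 * p ^ 4 * s ^ 2 + p ^ 6) * (r + 1)"

text \<open>For a polynomial \<open>q\<close>, an antiderivative of \<open>exp (- r) * q r\<close>
  is \<open>- exp (- r)\<close> times the sum of all derivatives of \<open>q\<close>. The prefactor
  is \<open>2 * pi\<^sup>2 / (24 * p ^ 3)\<close>. \<open>shell_primitive\<close> arises in the same
  way from \<open>r ^ 4\<close>.\<close>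

definition lens_primitive :: "real \<Rightarrow> real \<Rightarrow> real \<Rightarrow> real" where
  "lens_primitive p s r = - (pi\<^sup>2 / (12 * p ^ 3)) * (exp (- r) * lens_poly p s r)"

definition shell_primitive :: "real \<Rightarrow> real" where
  "shell_primitive r = - (8 * pi\<^sup>2 / 3) * (exp (- r) * (r ^ 4 + 4 * r ^ 3 + 12 * r ^ 2 + 24 * r + 24))"

lemma shell_primitive_deriv: "(shell_primitive has_real_derivative shell r) (at r)"
proof -
  have "((\<lambda>r. r ^ 4 + 4 * r ^ 3 + 12 * r ^ 2 + 24 * r + 24) has_real_derivative
      4 * r ^ 3 + 12 * r ^ 2 + 24 * r + 24) (at r)"
    by (rule derivative_eq_intros refl | simp)+
  moreover have "((\<lambda>r. exp (- r)) has_real_derivative - exp (- r)) (at r)"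
    by (auto intro!: derivative_eq_intros)
  ultimately have "(shell_primitive has_real_derivative - (8 * pi\<^sup>2 / 3) *
      (- exp (- r) * (r ^ 4 + 4 * r ^ 3 + 12 * r ^ 2 + 24 * r + 24) +
       (4 * r ^ 3 + 12 * r ^ 2 + 24 * r + 24) * exp (- r))) (at r)"
    unfolding shell_primitive_def[abs_def] by (intro DERIV_cmult DERIV_mult)
  then show ?thesis by (simp add: shell_def algebra_simps)
qed

lemma lens_primitive_deriv:
  assumes "p > 0"
  shows "(lens_primitive p s has_real_derivative lens p s r) (at r)"
proof -
  define d where "d = 7 * r ^ 6 + 42 * r ^ 5 + (42 - 3 * s ^ 2 - 9 * p ^ 2) * (5 * r ^ 4)
    + (210 - 15 * s ^ 2 - 45 * p ^ 2 + 16 * p ^ 3) * (4 * r ^ 3)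
    + (840 - 60 * s ^ 2 + 3 * s ^ 4 - 180 * p ^ 2 + 6 * p ^ 2 * s ^ 2 + 64 * p ^ 3 - 9 * p ^ 4) * (3 * r ^ 2)
    + (2520 - 180 * s ^ 2 + 9 * s ^ 4 - 540 * p ^ 2 + 18 * p ^ 2 * s ^ 2 + 192 * p ^ 3 - 27 * p ^ 4) * (2 * r)
    + (5040 - 360 * s ^ 2 + 18 * s ^ 4 - s ^ 6 - 1080 * p ^ 2 + 36 * p ^ 2 * s ^ 2 + 3 * p ^ 2 * s ^ 4
       + 384 * p ^ 3 - 54 * p ^ 4 - 3 * p ^ 4 * s ^ 2 + p ^ 6)"
  define m where "m = s\<^sup>2 - p\<^sup>2 - r\<^sup>2"
  have d: "(lens_poly p s has_real_derivative d) (at r)"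
    unfolding lens_poly_def[abs_def] d_def by (rule derivative_eq_intros refl | simp)+
  have e: "((\<lambda>r. exp (- r)) has_real_derivative - exp (- r)) (at r)"
    by (auto intro!: derivative_eq_intros)
  have "(lens_primitive p s has_real_derivative
      - (pi\<^sup>2 / (12 * p ^ 3)) * (- exp (- r) * lens_poly p s r + d * exp (- r))) (at r)"
    unfolding lens_primitive_def[abs_def] by (intro DERIV_cmult DERIV_mult e d)
  \<comment> \<open>The sum of all derivatives minus its own derivative telescopes to the original
    polynomial.\<close>
  moreover have "lens_poly p s r - d = r * (12 * r ^ 2 * p ^ 2 * m - m ^ 3 + 16 * r ^ 3 * p ^ 3)"
    unfolding lens_poly_def d_def m_def by algebra
  moreover have "- c * (- exp (- r) * lens_poly p s r + d * exp (- r)) = c * exp (- r) * (lens_poly p s r - d)"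
    for c by (simp add: algebra_simps)
  moreover have "lens p s r =
      pi\<^sup>2 / (12 * p ^ 3) * exp (- r) * (r * (12 * r ^ 2 * p ^ 2 * m - m ^ 3 + 16 * r ^ 3 * p ^ 3))"
  proof -
    have "cap_slice r (m / (2 * p)) = (12 * r ^ 2 * p ^ 2 * m - m ^ 3 + 16 * r ^ 3 * p ^ 3) / (24 * p ^ 3)"
      using assms by (simp add: cap_slice_def field_simps power2_eq_square power3_eq_cube)
    then show ?thesis unfolding lens_def m_def[symmetric] by simp
  qed
  ultimately show ?thesis by (simp only:)
qed

text \<open>The double zero at \<open>t = - r\<close> is there because the integral starts at a zero
  of its integrand. This form makes the sign for \<open>t \<le> 2 * r\<close> visible.\<close>

lemma cap_slice_factor: "cap_slice r t = (t + r)\<^sup>2 * (2 * r - t) / 3"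
proof -
  have "3 * cap_slice r t = 3 * r\<^sup>2 * t - t ^ 3 + 2 * r ^ 3"
    by (simp add: cap_slice_def field_simps)
  also have "\<dots> = (t + r)\<^sup>2 * (2 * r - t)" by algebra
  finally show ?thesis by simp
qed

lemma lens_nonneg:
  assumes "p > 0" "r \<ge> 0" "s \<ge> 0" "s \<le> p + r"
  shows "lens p s r \<ge> 0"
proof -
  have "s\<^sup>2 \<le> (p + r)\<^sup>2" using assms by (intro power_mono) auto
  then have "(s\<^sup>2 - p\<^sup>2 - r\<^sup>2) / (2 * p) \<le> r"
    using assms by (simp add: field_simps power2_eq_square)
  then show ?thesis using assms unfolding lens_def cap_slice_factor
    by (intro mult_nonneg_nonneg divide_nonneg_nonneg) auto
qed

lemma nn_integral_cap_slice:
  assumes "r \<ge> 0" "- r \<le> m" "m \<le> r"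
  shows "(\<integral>\<^sup>+t. ennreal (2 * pi\<^sup>2 * r * (r\<^sup>2 - t\<^sup>2)) * indicator {-r..m} t \<partial>lborel) =
    ennreal (2 * pi\<^sup>2 * r * cap_slice r m)"
proof -
  have "(\<integral>\<^sup>+t. ennreal (2 * pi\<^sup>2 * r * (r\<^sup>2 - t\<^sup>2)) * indicator {-r..m} t \<partial>lborel) =
      ennreal (2 * pi\<^sup>2 * r * cap_slice r m - 2 * pi\<^sup>2 * r * cap_slice r (- r))"
  proof (rule nn_integral_FTC_Icc)
    fix t assume "t \<in> {-r..m}"
    then have "\<bar>t\<bar> \<le> r" using assms by auto
    then have "t\<^sup>2 \<le> r\<^sup>2" by (metis abs_le_square_iff abs_of_nonneg assms(1))
    then show "0 \<le> 2 * pi\<^sup>2 * r * (r\<^sup>2 - t\<^sup>2)" using assms by simp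
    show "((\<lambda>t. 2 * pi\<^sup>2 * r * cap_slice r t) has_real_derivative 2 * pi\<^sup>2 * r * (r\<^sup>2 - t\<^sup>2)) (at t)"
      unfolding cap_slice_def by (auto intro!: derivative_eq_intros simp: algebra_simps)
  qed (use assms in auto)
  then show ?thesis by (simp add: cap_slice_factor)
qed

text \<open>A displacement of length \<open>r\<close> with axial component \<open>t\<close>, from a
  point at distance \<open>p\<close> from the centre, ends at squared distance
  \<open>r\<^sup>2 + 2 * p * t + p\<^sup>2\<close>. Membership in the ball is thus a threshold
  \<open>t \<le> m\<close>. The sphere misses the ball, lies inside it or is cut by it according to
  the position of \<open>m\<close> relative to \<open>- r\<close> and \<open>r\<close>.\<close>

lemma nn_integral_sphere_in_ball:
  assumes "p > 0" "s \<ge> 0"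
  shows "(\<integral>\<^sup>+t. ennreal (2 * pi\<^sup>2 * r * (r\<^sup>2 - t\<^sup>2)) * indicator {\<bar>t\<bar>..} r *
      (ennreal (exp (- r)) * indicator {..s\<^sup>2} (r\<^sup>2 + 2 * p * t + p\<^sup>2)) \<partial>lborel) =
    (if r < 0 \<or> \<bar>p - r\<bar> > s then 0 else ennreal (if r \<le> s - p then shell r else lens p s r))"
proof -
  define m where "m = (s\<^sup>2 - p\<^sup>2 - r\<^sup>2) / (2 * p)"
  have m: "r\<^sup>2 + 2 * p * t + p\<^sup>2 \<le> s\<^sup>2 \<longleftrightarrow> t \<le> m" for t
    unfolding m_def using assms by (simp add: field_simps)
  have ind: "indicator {\<bar>t\<bar>..} r * indicator {..s\<^sup>2} (r\<^sup>2 + 2 * p * t + p\<^sup>2) =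
     (indicator {-r..min m r} t :: ennreal)" for t
    using m[of t] by (auto simp: indicator_def)
  have "(\<integral>\<^sup>+t. ennreal (2 * pi\<^sup>2 * r * (r\<^sup>2 - t\<^sup>2)) * indicator {\<bar>t\<bar>..} r *
      (ennreal (exp (- r)) * indicator {..s\<^sup>2} (r\<^sup>2 + 2 * p * t + p\<^sup>2)) \<partial>lborel) =
    (\<integral>\<^sup>+t. ennreal (exp (- r)) * (ennreal (2 * pi\<^sup>2 * r * (r\<^sup>2 - t\<^sup>2)) * indicator {-r..min m r} t) \<partial>lborel)"
    unfolding ind[symmetric] by (simp add: mult_ac)
  also have "\<dots> = ennreal (exp (- r)) *
      (\<integral>\<^sup>+t. ennreal (2 * pi\<^sup>2 * r * (r\<^sup>2 - t\<^sup>2)) * indicator {-r..min m r} t \<partial>lborel)"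
    by (rule nn_integral_cmult) auto
  also have "\<dots> = (if r < 0 \<or> \<bar>p - r\<bar> > s then 0 else ennreal (if r \<le> s - p then shell r else lens p s r))"
  proof (cases "r < 0 \<or> \<bar>p - r\<bar> > s")
    case True
    have "min m r < - r" if "r \<ge> 0"
    proof -
      have "s < \<bar>p - r\<bar>" using True that by auto
      then have "s\<^sup>2 < (p - r)\<^sup>2" using assms
        by (metis abs_of_nonneg power2_abs power2_less_imp_less power_strict_mono zero_less_numeral)
      then have "m < - r" using assms by (simp add: m_def field_simps power2_eq_square)
      then show ?thesis by simp
    qed
    moreover have "min m r < - r" if "r < 0" using that by simp
    ultimately have "{- r..min m r} = {}" by (cases "r < 0") auto
    then show ?thesis using True by simp
  next
    case False
    then have r: "r \<ge> 0" and "\<bar>p - r\<bar> \<le> s" by auto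
    then have "(p - r)\<^sup>2 \<le> s\<^sup>2" by (metis abs_ge_zero power2_abs power_mono)
    then have m_ge: "- r \<le> m" using assms by (simp add: m_def field_simps power2_eq_square)
    have "m \<ge> r \<longleftrightarrow> (p + r)\<^sup>2 \<le> s\<^sup>2"
      using assms by (simp add: m_def field_simps power2_eq_square)
    also have "\<dots> \<longleftrightarrow> p + r \<le> s"
      using assms r by (simp add: power_mono_iff)
    finally have m_r: "m \<ge> r \<longleftrightarrow> r \<le> s - p" by auto
    have "ennreal (exp (- r)) *
        (\<integral>\<^sup>+t. ennreal (2 * pi\<^sup>2 * r * (r\<^sup>2 - t\<^sup>2)) * indicator {-r..min m r} t \<partial>lborel) =
        ennreal (exp (- r) * (2 * pi\<^sup>2 * r * cap_slice r (min m r)))"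
      using r m_ge by (subst nn_integral_cap_slice) (auto simp: ennreal_mult')
    also have "exp (- r) * (2 * pi\<^sup>2 * r * cap_slice r (min m r)) =
        (if r \<le> s - p then shell r else lens p s r)"
    proof (cases "r \<le> s - p")
      case True
      then have "min m r = r" using m_r by simp
      then show ?thesis using True by (simp add: shell_def cap_slice_def field_simps power2_eq_square
          power3_eq_cube power4_eq_xxxx)
    next
      case False
      then have "min m r = m" using m_r by simp
      then show ?thesis using False by (simp add: lens_def m_def)
    qed
    finally show ?thesis using False by simp
  qed
  finally show ?thesis .
qed

section \<open>The potential of a ball in closed form\<close>

lemma ball_kernel_measurable:
  fixes x :: "'a::euclidean_space"
  shows "(\<lambda>y. indicator (cball 0 s) y * exp (- dist x y)) \<in> borel_measurable borel"
proof -
  have "(\<lambda>y. exp (- dist x y)) \<in> borel_measurable borel"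
    by (intro borel_measurable_continuous_onI continuous_intros)
  then show ?thesis
    by (intro borel_measurable_times borel_measurable_indicator borel_closed closed_cball)
qed

definition ball_potential :: "'a::euclidean_space \<Rightarrow> real \<Rightarrow> real" where
  "ball_potential x s = (LINT y|lborel. indicator (cball 0 s) y * exp (- dist x y))"

text \<open>With the evaluation point as origin, the kernel depends on the distance \<open>r\<close>
  alone and the ball condition on \<open>r\<close> and the axial coordinate \<open>t\<close>.
  Tonelli moves the integral over \<open>r\<close> outside.\<close>

lemma nn_integral_ball_potential_axis:
  fixes b :: "'a::euclidean_space"
  assumes dim: "DIM('a) = 5" and b: "b \<in> Basis" and ps: "p > 0" "s \<ge> 0"
  shows "(\<integral>\<^sup>+y. ennreal (indicator (cball 0 s) y * exp (- dist (p *\<^sub>R b) y)) \<partial>lborel) =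
    (\<integral>\<^sup>+r. (if r < 0 \<or> \<bar>p - r\<bar> > s then 0 else ennreal (if r \<le> s - p then shell r else lens p s r)) \<partial>lborel)"
proof -
  define F where "F = (\<lambda>(r :: real, t). ennreal (exp (- r)) * indicator {..s\<^sup>2} (r\<^sup>2 + 2 * p * t + p\<^sup>2))"
  have F_meas [measurable]: "F \<in> borel_measurable borel"
    unfolding F_def borel_prod[symmetric] by measurable
  have "(\<integral>\<^sup>+y. ennreal (indicator (cball 0 s) y * exp (- dist (p *\<^sub>R b) y)) \<partial>lborel) =
      (\<integral>\<^sup>+y. ennreal (indicator (cball 0 s) y * exp (- dist (p *\<^sub>R b) y))
        \<partial>distr lborel borel ((+) (p *\<^sub>R b)))"
    by (simp add: lborel_distr_plus)
  also have "\<dots> = (\<integral>\<^sup>+z. ennreal (indicator (cball 0 s) (p *\<^sub>R b + z) * exp (- dist (p *\<^sub>R b) (p *\<^sub>R b + z)))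
        \<partial>lborel)"
    using ball_kernel_measurable[of s "p *\<^sub>R b"] by (intro nn_integral_distr) auto
  also have "\<dots> = (\<integral>\<^sup>+z. F (norm z, z \<bullet> b) \<partial>lborel)"
  proof (rule nn_integral_cong)
    fix z :: 'a
    have "norm (p *\<^sub>R b + z) \<le> s \<longleftrightarrow> (norm (p *\<^sub>R b + z))\<^sup>2 \<le> s\<^sup>2"
      using ps by (simp add: power_mono_iff)
    then have *: "p *\<^sub>R b + z \<in> cball 0 s \<longleftrightarrow> (norm (p *\<^sub>R b + z))\<^sup>2 \<le> s\<^sup>2"
      by simp
    have "(norm (p *\<^sub>R b + z))\<^sup>2 = (norm z)\<^sup>2 + 2 * p * (z \<bullet> b) + p\<^sup>2"
      using b unfolding power2_norm_eq_inner
      by (simp add: inner_simps inner_commute power2_eq_square algebra_simps)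
    then show "ennreal (indicator (cball 0 s) (p *\<^sub>R b + z) * exp (- dist (p *\<^sub>R b) (p *\<^sub>R b + z))) =
        F (norm z, z \<bullet> b)"
      by (simp add: F_def indicator_def dist_norm * del: mem_cball mem_cball_0)
  qed
  also have "\<dots> = (\<integral>\<^sup>+t. \<integral>\<^sup>+r. ennreal (2 * pi\<^sup>2 * r * (r\<^sup>2 - t\<^sup>2)) * indicator {\<bar>t\<bar>..} r * F (r, t) \<partial>lborel \<partial>lborel)"
    by (rule nn_integral_norm_coordinate[OF dim b F_meas])
  also have "\<dots> = (\<integral>\<^sup>+r. \<integral>\<^sup>+t. ennreal (2 * pi\<^sup>2 * r * (r\<^sup>2 - t\<^sup>2)) * indicator {\<bar>t\<bar>..} r * F (r, t) \<partial>lborel \<partial>lborel)"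
  proof (rule lborel_pair.Fubini')
    have "{x :: real \<times> real. \<bar>snd x\<bar> \<le> fst x} \<in> sets borel"
      by (intro borel_closed closed_Collect_le continuous_intros)
    then have "(indicator {x :: real \<times> real. \<bar>snd x\<bar> \<le> fst x} :: _ \<Rightarrow> ennreal) \<in> borel_measurable lborel"
      by simp
    moreover have "indicator {x :: real \<times> real. \<bar>snd x\<bar> \<le> fst x} =
        (\<lambda>(r :: real, t). indicator {\<bar>t\<bar>..} r :: ennreal)"
      by (auto simp: indicator_def fun_eq_iff)
    ultimately have [measurable]: "(\<lambda>(r :: real, t). indicator {\<bar>t\<bar>..} r :: ennreal) \<in> borel_measurable (lborel \<Otimes>\<^sub>M lborel)"
      by (simp add: lborel_prod)
    have [measurable]: "F \<in> borel_measurable (lborel \<Otimes>\<^sub>M lborel)" by (simp add: lborel_prod)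
    show "(\<lambda>(r, t). ennreal (2 * pi\<^sup>2 * r * (r\<^sup>2 - t\<^sup>2)) * indicator {\<bar>t\<bar>..} r * F (r, t))
        \<in> borel_measurable (lborel \<Otimes>\<^sub>M lborel)"
      by measurable
  qed
  also have "\<dots> = (\<integral>\<^sup>+r. (if r < 0 \<or> \<bar>p - r\<bar> > s then 0 else ennreal (if r \<le> s - p then shell r else lens p s r)) \<partial>lborel)"
    unfolding F_def prod.case nn_integral_sphere_in_ball[OF ps] ..
  finally show ?thesis .
qed

text \<open>A rotation taking \<open>x\<close> to \<open>y\<close> preserves Lebesgue measure,
  distances and the centred ball. Hence points on one axis represent all points.\<close>

lemma ball_potential_norm:
  fixes x y :: "real ^ 'n::{finite,wellorder}"
  assumes "norm x = norm y"
  shows "ball_potential x s = ball_potential y s"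
proof -
  obtain T where T: "orthogonal_transformation T" "T x = y"
    using orthogonal_transformation_exists[OF assms] by auto
  have [measurable]: "T \<in> borel_measurable borel"
    using orthogonal_transformation_linear[OF T(1)]
    by (intro borel_measurable_continuous_onI linear_continuous_on linear_conv_bounded_linear[THEN iffD1])
  note meas = ball_kernel_measurable[of s y]
  have "ball_potential y s = (LINT z|distr lborel borel T. indicator (cball 0 s) z * exp (- dist y z))"
    by (simp add: ball_potential_def lborel_orthogonal_transformation[OF T(1)])
  also have "\<dots> = (LINT z|lborel. indicator (cball 0 s) (T z) * exp (- dist y (T z)))"
    using meas by (subst integral_distr) auto
  also have "\<dots> = ball_potential x s"
    unfolding ball_potential_def T(2)[symmetric] using T(1)
    by (simp add: orthogonal_transformation_isometry indicator_def orthogonal_transformation_norm)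
  finally show ?thesis ..
qed

lemma ball_potential_axis:
  fixes b :: "'a::euclidean_space"
  assumes dim: "DIM('a) = 5" and b: "b \<in> Basis" and ps: "p > 0" "s \<ge> 0"
  shows "ball_potential (p *\<^sub>R b) s =
    (if p \<le> s then shell_primitive (s - p) - shell_primitive 0 + (lens_primitive p s (s + p) - lens_primitive p s (s - p))
     else lens_primitive p s (p + s) - lens_primitive p s (p - s))"
proof -
  let ?W = "\<lambda>r. if r < 0 \<or> \<bar>p - r\<bar> > s then 0 else ennreal (if r \<le> s - p then shell r else lens p s r)"
  note meas = ball_kernel_measurable[of s "p *\<^sub>R b"]
  have pot: "ball_potential (p *\<^sub>R b) s = enn2real (\<integral>\<^sup>+r. ?W r \<partial>lborel)"
    unfolding ball_potential_def nn_integral_ball_potential_axis[OF dim b ps, symmetric]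
    by (rule integral_eq_nn_integral) (use meas in auto)
  have [measurable]: "lens p s \<in> borel_measurable borel" "shell \<in> borel_measurable borel"
    unfolding lens_def[abs_def] shell_def[abs_def] cap_slice_def by measurable
  have FTC: "(\<integral>\<^sup>+r. ennreal (lens p s r) * indicator {\<bar>s - p\<bar>..s + p} r \<partial>lborel) =
      ennreal (lens_primitive p s (s + p) - lens_primitive p s \<bar>s - p\<bar>)"
    "lens_primitive p s \<bar>s - p\<bar> \<le> lens_primitive p s (s + p)"
  proof -
    have nn: "0 \<le> lens p s r" if "r \<in> {\<bar>s - p\<bar>..s + p}" for r
      using that ps by (intro lens_nonneg) auto
    have le: "\<bar>s - p\<bar> \<le> s + p" using ps by auto
    show "(\<integral>\<^sup>+r. ennreal (lens p s r) * indicator {\<bar>s - p\<bar>..s + p} r \<partial>lborel) =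
        ennreal (lens_primitive p s (s + p) - lens_primitive p s \<bar>s - p\<bar>)"
      using lens_primitive_deriv ps nn le by (intro nn_integral_FTC_Icc) auto
    show "lens_primitive p s \<bar>s - p\<bar> \<le> lens_primitive p s (s + p)"
      by (rule DERIV_nonneg_imp_nondecreasing[OF le])
        (use lens_primitive_deriv[OF ps(1)] nn atLeastAtMost_iff in blast)
  qed
  show ?thesis
  proof (cases "p \<le> s")
    case True
    have shell_nn: "shell r \<ge> 0" for r by (simp add: shell_def)
    \<comment> \<open>The radius \<open>s - p\<close> belongs to both closed intervals below, where
      the two contributions would be added.\<close>
    have "AE r in lborel. r \<noteq> s - p" by (rule AE_lborel_singleton)
    then have "(\<integral>\<^sup>+r. ?W r \<partial>lborel) =
        (\<integral>\<^sup>+r. ennreal (shell r) * indicator {0..s - p} r + ennreal (lens p s r) * indicator {\<bar>s - p\<bar>..s + p} r \<partial>lborel)"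
      by (intro nn_integral_cong_AE, elim AE_mp) (use True ps in \<open>auto simp: indicator_def\<close>)
    also have "\<dots> = (\<integral>\<^sup>+r. ennreal (shell r) * indicator {0..s - p} r \<partial>lborel) +
        (\<integral>\<^sup>+r. ennreal (lens p s r) * indicator {\<bar>s - p\<bar>..s + p} r \<partial>lborel)"
      by (rule nn_integral_add) auto
    also have "(\<integral>\<^sup>+r. ennreal (shell r) * indicator {0..s - p} r \<partial>lborel) =
        ennreal (shell_primitive (s - p) - shell_primitive 0)"
      using shell_primitive_deriv shell_nn True by (intro nn_integral_FTC_Icc) auto
    finally have "(\<integral>\<^sup>+r. ?W r \<partial>lborel) = ennreal (shell_primitive (s - p) - shell_primitive 0) +
        ennreal (lens_primitive p s (s + p) - lens_primitive p s \<bar>s - p\<bar>)"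
      by (simp only: FTC)
    moreover have "shell_primitive 0 \<le> shell_primitive (s - p)"
      by (rule DERIV_nonneg_imp_nondecreasing) (use shell_primitive_deriv shell_nn True in auto)
    ultimately show ?thesis using True FTC(2) unfolding pot by (simp flip: ennreal_plus)
  next
    case False
    then have "(\<integral>\<^sup>+r. ?W r \<partial>lborel) =
        (\<integral>\<^sup>+r. ennreal (lens p s r) * indicator {\<bar>s - p\<bar>..s + p} r \<partial>lborel)"
      using ps by (intro nn_integral_cong) (auto simp: indicator_def)
    then show ?thesis using False FTC(2) unfolding pot FTC by (simp add: add.commute)
  qed
qed

text \<open>Reverse Bessel polynomials.\<close>

definition theta2 :: "real \<Rightarrow> real" where "theta2 s = s ^ 2 + 3 * s + 3"
definition theta3 :: "real \<Rightarrow> real" where "theta3 s = s ^ 3 + 6 * s ^ 2 + 15 * s + 15"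
definition theta4 :: "real \<Rightarrow> real" where "theta4 s = s ^ 4 + 10 * s ^ 3 + 45 * s ^ 2 + 105 * s + 105"

text \<open>The potential of the ball of radius \<open>s\<close> at distance \<open>p\<close> from its centre, valid for \<open>p \<le> s\<close>; the
  formula is also evaluated for \<open>p > s\<close>, as an analytic continuation.\<close>

definition inner_potential :: "real \<Rightarrow> real \<Rightarrow> real" where
  "inner_potential p s = shell_primitive (s - p) - shell_primitive 0 +
     (lens_primitive p s (s + p) - lens_primitive p s (s - p))"

text \<open>The endpoints \<open>s - p\<close> and \<open>s + p\<close> produce
  \<open>exp (- s)\<close> times \<open>exp p\<close> and \<open>exp (- p)\<close>, and the
  polynomial factors separate \<open>s\<close> from \<open>p\<close>. Cancelling the three terms in
  \<open>s\<close> therefore works for all \<open>p\<close> at once.\<close>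

lemma inner_potential_eq:
  assumes "p > 0"
  shows "inner_potential p s = 64 * pi\<^sup>2 - 4 * pi\<^sup>2 / p ^ 3 * exp (- s) *
    (exp p * (p ^ 3 * theta2 s - 2 * p ^ 2 * theta3 s + (p - 1) * theta4 s) +
     exp (- p) * (p ^ 3 * theta2 s + 2 * p ^ 2 * theta3 s + (p + 1) * theta4 s))"
proof -
  define r where "r = s - p"
  define A where "A = p ^ 3 * theta2 s - 2 * p ^ 2 * theta3 s + (p - 1) * theta4 s"
  define B where "B = p ^ 3 * theta2 s + 2 * p ^ 2 * theta3 s + (p + 1) * theta4 s"
  have hi: "lens_poly p s (s + p) = 48 * B"
    unfolding lens_poly_def B_def theta2_def theta3_def theta4_def by algebra
  \<comment> \<open>\<open>32 * p ^ 3\<close> is the ratio of the prefactors of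
    \<open>shell_primitive\<close> and \<open>lens_primitive\<close>, which meet at
    \<open>r\<close>.\<close>
  have lo: "32 * p ^ 3 * (r ^ 4 + 4 * r ^ 3 + 12 * r ^ 2 + 24 * r + 24) = lens_poly p s r + 48 * A"
    unfolding lens_poly_def A_def theta2_def theta3_def theta4_def r_def by algebra
  have "shell_primitive r - lens_primitive p s r =
     - (pi\<^sup>2 / (12 * p ^ 3)) * exp (- r) *
       (32 * p ^ 3 * (r ^ 4 + 4 * r ^ 3 + 12 * r ^ 2 + 24 * r + 24) - lens_poly p s r)"
  proof -
    have "- (8 * pi\<^sup>2 / 3) * (E * Q) = - (pi\<^sup>2 / (12 * p ^ 3)) * E * (32 * p ^ 3 * Q)" for E Q
      using assms by simp
    then show ?thesis
      unfolding shell_primitive_def lens_primitive_def by (simp only: right_diff_distrib mult.assoc)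
  qed
  also have "\<dots> = - (4 * pi\<^sup>2 / p ^ 3) * exp (- s) * exp p * A"
  proof -
    have "exp (- r) = exp (- s) * exp p" by (simp add: r_def flip: exp_add)
    then show ?thesis unfolding lo by simp
  qed
  finally have 1: "shell_primitive r - lens_primitive p s r = - (4 * pi\<^sup>2 / p ^ 3) * exp (- s) * exp p * A" .
  have 2: "lens_primitive p s (s + p) = - (4 * pi\<^sup>2 / p ^ 3) * exp (- s) * exp (- p) * B"
    unfolding lens_primitive_def hi by (simp add: exp_add exp_minus exp_diff field_simps)
  have 3: "shell_primitive 0 = - (64 * pi\<^sup>2)" by (simp add: shell_primitive_def)
  have "inner_potential p s = (shell_primitive r - lens_primitive p s r) - shell_primitive 0 + lens_primitive p s (s + p)"
    by (simp add: inner_potential_def r_def)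
  also have "\<dots> = 64 * pi\<^sup>2 - 4 * pi\<^sup>2 / p ^ 3 * exp (- s) * (exp p * A + exp (- p) * B)"
    unfolding 1 2 3 by (simp add: algebra_simps add_divide_distrib)
  finally show ?thesis unfolding A_def B_def .
qed

lemma ball_potential_eq:
  fixes x :: "real ^ 5"
  assumes "x \<noteq> 0" "s \<ge> 0"
  shows "ball_potential x s = (if norm x \<le> s then inner_potential (norm x) s
     else lens_primitive (norm x) s (norm x + s) - lens_primitive (norm x) s (norm x - s))"
proof -
  let ?b = "axis 1 1 :: real ^ 5"
  have "ball_potential x s = ball_potential (norm x *\<^sub>R ?b) s"
    by (rule ball_potential_norm) simp
  then show ?thesis
    using assms ball_potential_axis[of ?b "norm x" s]
    by (simp add: inner_potential_def)
qed

text \<open>The exponent 6 is the order of the operator \<open>(I - \<Delta>)\<^sup>3\<close> whose fundamental solution is the kernel.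
  It has to beat the cube in the denominators of the ball weights below, which enter squared.\<close>

lemma outer_potential_bound:
  fixes x :: "real ^ 5"
  assumes "0 \<le> s" "s < norm x"
  shows "\<bar>ball_potential x s - inner_potential (norm x) s\<bar> \<le> 8 * pi\<^sup>2 * exp (norm x - s) * (norm x - s) ^ 6"
proof -
  define p where "p = norm x"
  define d where "d = p - s"
  have p: "p > 0" "d > 0" "d \<le> p" using assms by (auto simp: p_def d_def)
  \<comment> \<open>\<open>p\<close> and \<open>s\<close> stay fixed. The term at
    \<open>s + p\<close> is common to both formulas and drops out, so the difference is
    \<open>- h d\<close>, with \<open>h 0 = 0\<close>.\<close>
  define h where "h r = lens_primitive p s r - lens_primitive p s (- r) + shell_primitive (- r) - shell_primitive 0" for r
  define h' where "h' r = lens p s r + lens p s (- r) - shell (- r)" for r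
  have h'_h: "(h has_real_derivative h' r) (at r)" for r
  proof -
    have "((\<lambda>r. lens_primitive p s (- r)) has_real_derivative - lens p s (- r)) (at r)"
      by (rule DERIV_mirror[THEN iffD1, OF lens_primitive_deriv[OF p(1)]])
    moreover have "((\<lambda>r. shell_primitive (- r)) has_real_derivative - shell (- r)) (at r)"
      by (rule DERIV_mirror[THEN iffD1, OF shell_primitive_deriv])
    ultimately have "(h has_real_derivative lens p s r - - lens p s (- r) + - shell (- r) - 0) (at r)"
      unfolding h_def using lens_primitive_deriv[OF p(1), of s r]
      by (intro DERIV_diff DERIV_add DERIV_const)
    then show ?thesis by (simp add: h'_def)
  qed
  have diff: "ball_potential x s - inner_potential (norm x) s = - (h d - h 0)"
    using assms p(1) ball_potential_eq[of x s] unfolding p_def zero_less_norm_iff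
    by (auto simp: h_def inner_potential_def p_def d_def algebra_simps)
  obtain z where z: "0 < z" "z < d" "h d - h 0 = (d - 0) * h' z"
    using MVT2[OF p(2), of h h'] h'_h by auto
  define m where "m = (s\<^sup>2 - p\<^sup>2 - z\<^sup>2) / (2 * p)"
  have s: "s = p - d" by (simp add: d_def)
  have zd: "z\<^sup>2 \<le> d\<^sup>2" using z by (intro power_mono) auto
  have m: "\<bar>m\<bar> \<le> d"
  proof -
    have "p\<^sup>2 - s\<^sup>2 = d * (2 * p - d)" by (simp add: s power2_eq_square algebra_simps)
    then have "p\<^sup>2 + z\<^sup>2 - s\<^sup>2 \<le> 2 * p * d" using zd by (simp add: power2_eq_square algebra_simps)
    moreover have "s\<^sup>2 \<le> p\<^sup>2" using assms p_def by (intro power_mono) auto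
    moreover have "0 \<le> 2 * p * d" using p by simp
    ultimately have "p\<^sup>2 + z\<^sup>2 - s\<^sup>2 \<le> 2 * p * d" "s\<^sup>2 - p\<^sup>2 - z\<^sup>2 \<le> 2 * p * d"
      using zero_le_power2[of z] by linarith+
    then show ?thesis
      using p(1) unfolding m_def abs_le_iff by (simp add: field_simps)
  qed
  have cap: "\<bar>cap_slice z m\<bar> \<le> 2 * d ^ 3"
  proof -
    have "\<bar>z\<^sup>2 * m\<bar> \<le> d\<^sup>2 * d"
      using mult_mono[OF zd m] by (simp add: abs_mult)
    moreover have "\<bar>m ^ 3\<bar> \<le> d ^ 3" unfolding power_abs using m by (intro power_mono) auto
    moreover have "\<bar>z ^ 3\<bar> \<le> d ^ 3" unfolding power_abs using z by (intro power_mono) auto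
    ultimately show ?thesis
      unfolding cap_slice_def by (simp add: power2_eq_square power3_eq_cube)
  qed
  \<comment> \<open>Reflecting \<open>z\<close> changes \<open>cap_slice\<close> by a cubic term
    that cancels against \<open>shell\<close>. Only a difference of exponentials remains, which is
    itself small.\<close>
  have "h' z = 2 * pi\<^sup>2 * z * cap_slice z m * (exp (- z) - exp z)"
  proof -
    have "lens p s z = 2 * pi\<^sup>2 * z * exp (- z) * cap_slice z m"
      by (simp add: lens_def m_def)
    moreover have "lens p s (- z) = - (2 * pi\<^sup>2 * z * exp z * cap_slice (- z) m)"
      by (simp add: lens_def m_def)
    moreover have "cap_slice (- z) m = cap_slice z m - 4 / 3 * z ^ 3"
      by (simp add: cap_slice_def)
    ultimately show ?thesis
      unfolding h'_def shell_def by (simp add: algebra_simps power_numeral_reduce)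
  qed
  then have "\<bar>h' z\<bar> = 2 * pi\<^sup>2 * (z * \<bar>cap_slice z m\<bar>) * (exp z - exp (- z))"
    using z by (simp add: abs_mult)
  \<comment> \<open>The six powers of \<open>d\<close>: one from the mean value theorem, one from
    \<open>z\<close>, three from \<open>cap_slice\<close>, one from the exponentials.\<close>
  also have "\<dots> \<le> 2 * pi\<^sup>2 * (d * (2 * d ^ 3)) * (2 * d * exp d)"
  proof -
    have "exp z - exp (- z) = exp z * (1 - exp (- (2 * z)))"
      by (simp add: algebra_simps flip: exp_add)
    also have "\<dots> \<le> exp d * (2 * d)"
      using exp_ge_add_one_self[of "- (2 * z)"] z by (intro mult_mono) auto
    finally have "exp z - exp (- z) \<le> 2 * d * exp d" by (simp add: mult.commute)
    then show ?thesis
      using z cap by (intro mult_mono mult_left_mono) auto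
  qed
  also have "\<dots> = 8 * pi\<^sup>2 * exp d * d ^ 5" by (simp add: power_numeral_reduce)
  finally have "\<bar>h d - h 0\<bar> \<le> d * (8 * pi\<^sup>2 * exp d * d ^ 5)"
    using z p by (simp add: abs_mult)
  also have "\<dots> = 8 * pi\<^sup>2 * exp d * d ^ 6" by (simp add: power_numeral_reduce)
  finally show ?thesis unfolding diff by (simp add: d_def p_def)
qed

section \<open>Weights that make the potential constant\<close>

text \<open>Unlike Newton's divided differences these carry no factorial, so the limit is the
  derivative of order \<open>k\<close> itself.\<close>

fun diff_quot :: "nat \<Rightarrow> (real \<Rightarrow> real) \<Rightarrow> real \<Rightarrow> real \<Rightarrow> real" where
  "diff_quot 0 f e s = f s"
| "diff_quot (Suc k) f e s = (diff_quot k f e (s + e) - diff_quot k f e s) / e"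

lemma diff_quot_deriv:
  assumes "\<And>x. (f has_real_derivative f' x) (at x)"
  shows "(diff_quot k f e has_real_derivative diff_quot k f' e x) (at x)"
proof (induction k arbitrary: x)
  case 0
  have "diff_quot 0 f e = f" by (simp add: fun_eq_iff)
  then show ?case using assms by simp
next
  case (Suc k)
  have "((\<lambda>s. diff_quot k f e (s + e)) has_real_derivative diff_quot k f' e (x + e)) (at x)"
    using Suc[of "x + e"] by (simp add: DERIV_shift)
  then have "((\<lambda>s. (diff_quot k f e (s + e) - diff_quot k f e s) / e) has_real_derivative
      (diff_quot k f' e (x + e) - diff_quot k f' e x) / e) (at x)"
    by (intro DERIV_cdivide DERIV_diff Suc)
  moreover have "diff_quot (Suc k) f e = (\<lambda>s. (diff_quot k f e (s + e) - diff_quot k f e s) / e)"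
    by (simp add: fun_eq_iff)
  ultimately show ?case by simp
qed

text \<open>Difference quotients commute with differentiation, so one mean value step trades an
  order of the quotient for a derivative.\<close>

lemma diff_quot_mean_value:
  fixes e s :: real and k :: nat
  assumes "\<And>i x. (F i has_real_derivative F (Suc i) x) (at x)" "e > 0"
  shows "\<exists>z. s \<le> z \<and> z \<le> s + k * e \<and> diff_quot k (F i) e s = F (i + k) z"
proof (induction k arbitrary: i s)
  case (Suc k)
  obtain y where y: "s < y" "y < s + e"
    "diff_quot k (F i) e (s + e) - diff_quot k (F i) e s = (s + e - s) * diff_quot k (F (Suc i)) e y"
    using MVT2[of s "s + e" "diff_quot k (F i) e" "diff_quot k (F (Suc i)) e"] diff_quot_deriv[OF assms(1)] assms(2)
    by auto
  obtain z where "y \<le> z" "z \<le> y + k * e" "diff_quot k (F (Suc i)) e y = F (Suc i + k) z"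
    using Suc by blast
  then show ?case using y assms(2)
    by (intro exI[of _ z]) (auto simp: algebra_simps)
qed auto

lemma diff_quot_tendsto:
  fixes s :: real and k :: nat
  assumes F: "\<And>i x. (F i has_real_derivative F (Suc i) x) (at x)"
  shows "((\<lambda>e. diff_quot k (F 0) e s) \<longlongrightarrow> F k s) (at_right 0)"
proof -
  have "\<forall>e\<in>{0::real<..}. \<exists>z. s \<le> z \<and> z \<le> s + real k * e \<and> diff_quot k (F 0) e s = F k z"
  proof
    fix e :: real assume "e \<in> {0<..}"
    then show "\<exists>z. s \<le> z \<and> z \<le> s + real k * e \<and> diff_quot k (F 0) e s = F k z"
      using diff_quot_mean_value[of F e s k 0] F by simp
  qed
  from bchoice[OF this]
  obtain z where z: "\<And>e::real. e > 0 \<Longrightarrow> s \<le> z e \<and> z e \<le> s + real k * e \<and> diff_quot k (F 0) e s = F k (z e)"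
    by auto
  have "(z \<longlongrightarrow> s) (at_right 0)"
  proof (rule tendsto_sandwich[where f="\<lambda>_. s" and h="\<lambda>e::real. s + real k * e"])
    show "\<forall>\<^sub>F e in at_right 0. s \<le> z e"
      using eventually_at_right_less[of "0::real"] by eventually_elim (simp add: z)
    show "\<forall>\<^sub>F e in at_right 0. z e \<le> s + real k * e"
      using eventually_at_right_less[of "0::real"] by eventually_elim (simp add: z)
    have "((\<lambda>e::real. s + real k * e) \<longlongrightarrow> s + real k * 0) (at_right 0)" by (intro tendsto_intros)
    then show "((\<lambda>e::real. s + real k * e) \<longlongrightarrow> s) (at_right 0)" by simp
  qed simp
  then have "((\<lambda>e. F k (z e)) \<longlongrightarrow> F k s) (at_right 0)"
    using DERIV_isCont[OF F[of k s]] by (rule isCont_tendsto_compose[rotated])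
  moreover have "\<forall>\<^sub>F e in at_right 0. F k (z e) = diff_quot k (F 0) e s"
    using eventually_at_right_less[of "0::real"] by eventually_elim (simp add: z)
  ultimately show ?thesis by (rule Lim_transform_eventually)
qed

text \<open>Weights on equidistant nodes that annihilate \<open>theta2\<close>, \<open>theta3\<close> and \<open>theta4\<close> are obtained by
  Cramer's rule: \<open>theta_det f e s\<close> is linear in \<open>f\<close> and vanishes at these three functions. With
  difference quotients instead of point values its limit for \<open>e \<rightarrow> 0\<close> is a Wronskian.\<close>

definition minor3 :: "(nat \<Rightarrow> real) \<Rightarrow> (nat \<Rightarrow> real) \<Rightarrow> (nat \<Rightarrow> real) \<Rightarrow> nat \<Rightarrow> nat \<Rightarrow> nat \<Rightarrow> real" where
  "minor3 b c d i j k = b i * (c j * d k - c k * d j) - b j * (c i * d k - c k * d i) + b k * (c i * d j - c j * d i)"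

definition det4 :: "(nat \<Rightarrow> real) \<Rightarrow> (nat \<Rightarrow> real) \<Rightarrow> (nat \<Rightarrow> real) \<Rightarrow> (nat \<Rightarrow> real) \<Rightarrow> real" where
  "det4 a b c d = a 0 * minor3 b c d 1 2 3 - a 1 * minor3 b c d 0 2 3 + a 2 * minor3 b c d 0 1 3 - a 3 * minor3 b c d 0 1 2"

lemma det4_eq_0: "det4 b b c d = 0" "det4 c b c d = 0" "det4 d b c d = 0"
  unfolding det4_def minor3_def by algebra+

lemma det4_tendsto:
  assumes "\<And>i. ((\<lambda>e. a e i) \<longlongrightarrow> a' i) F" "\<And>i. ((\<lambda>e. b e i) \<longlongrightarrow> b' i) F"
    "\<And>i. ((\<lambda>e. c e i) \<longlongrightarrow> c' i) F" "\<And>i. ((\<lambda>e. d e i) \<longlongrightarrow> d' i) F"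
  shows "((\<lambda>e. det4 (a e) (b e) (c e) (d e)) \<longlongrightarrow> det4 a' b' c' d') F"
  unfolding det4_def minor3_def by (intro tendsto_intros assms)

definition theta_det :: "(real \<Rightarrow> real) \<Rightarrow> real \<Rightarrow> real \<Rightarrow> real" where
  "theta_det f e s = det4 (\<lambda>k. diff_quot k f e s) (\<lambda>k. diff_quot k theta2 e s)
     (\<lambda>k. diff_quot k theta3 e s) (\<lambda>k. diff_quot k theta4 e s)"

lemma poly_derivs:
  fixes p :: "real poly"
  shows "(poly ((pderiv ^^ i) p) has_real_derivative poly ((pderiv ^^ Suc i) p) x) (at x)"
  using poly_DERIV[of "(pderiv ^^ i) p" x] by simp

lemma exp_poly_derivs:
  fixes p :: "real poly"
  defines "D \<equiv> \<lambda>q. q + pderiv q"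
  shows "((\<lambda>x. exp x * poly ((D ^^ i) p) x) has_real_derivative exp x * poly ((D ^^ Suc i) p) x) (at x)"
  using poly_DERIV[of "(D ^^ i) p" x]
  by (auto intro!: derivative_eq_intros simp: D_def algebra_simps)

lemma theta_poly:
  "theta2 = poly [:3, 3, 1:]" "theta3 = poly [:15, 15, 6, 1:]" "theta4 = poly [:105, 105, 45, 10, 1:]"
  by (auto simp: fun_eq_iff theta2_def theta3_def theta4_def algebra_simps power_numeral_reduce)

lemma theta_det_exp_poly_tendsto:
  fixes p :: "real poly"
  defines "D \<equiv> \<lambda>q. q + pderiv q"
  shows "((\<lambda>e. theta_det (\<lambda>x. exp x * poly p x) e s) \<longlongrightarrow>
    det4 (\<lambda>k. exp s * poly ((D ^^ k) p) s) (\<lambda>k. poly ((pderiv ^^ k) [:3, 3, 1:]) s)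
     (\<lambda>k. poly ((pderiv ^^ k) [:15, 15, 6, 1:]) s) (\<lambda>k. poly ((pderiv ^^ k) [:105, 105, 45, 10, 1:]) s)) (at_right 0)"
  unfolding theta_det_def theta_poly
proof (rule det4_tendsto)
  show "((\<lambda>e. diff_quot i (\<lambda>x. exp x * poly p x) e s) \<longlongrightarrow> exp s * poly ((D ^^ i) p) s) (at_right 0)" for i
    using diff_quot_tendsto[of "\<lambda>i x. exp x * poly ((D ^^ i) p) x" i s] exp_poly_derivs[of _ p]
    unfolding D_def by simp
qed (use diff_quot_tendsto[of "\<lambda>i. poly ((pderiv ^^ i) _)", OF poly_derivs] in simp)+

text \<open>For \<open>s > 0\<close> the limit is nonzero, so Cramer's rule applies for small
  \<open>e\<close>. The factor \<open>s + 3\<close> becomes the denominator of the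
  magnitude.\<close>

lemma theta_det_exp_tendsto: "((\<lambda>e. theta_det exp e s) \<longlongrightarrow> - 2 * exp s * s ^ 5 * (s + 3)) (at_right 0)"
proof -
  have "((\<lambda>e. theta_det (\<lambda>x. exp x * poly 1 x) e s) \<longlongrightarrow> - 2 * exp s * s ^ 5 * (s + 3)) (at_right 0)"
    by (rule theta_det_exp_poly_tendsto[THEN tendsto_eq_rhs])
      (simp add: det4_def minor3_def pderiv_pCons numeral_2_eq_2 numeral_3_eq_3, algebra)
  then show ?thesis by simp
qed

text \<open>The fifth power is the growth of the volume of a ball; the exponential compensates the
  factor \<open>exp (- s)\<close> in the inner potential.\<close>

lemma theta_det_exp_power5_tendsto:
  "((\<lambda>e. theta_det (\<lambda>x. exp x * x ^ 5) e s) \<longlongrightarrow>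
     - 2 * exp s * s ^ 5 * (s ^ 6 + 18 * s ^ 5 + 135 * s ^ 4 + 525 * s ^ 3 + 1080 * s\<^sup>2 + 1080 * s + 360)) (at_right 0)"
proof -
  have "((\<lambda>e. theta_det (\<lambda>x. exp x * poly [:0, 0, 0, 0, 0, 1:] x) e s) \<longlongrightarrow>
     - 2 * exp s * s ^ 5 * (s ^ 6 + 18 * s ^ 5 + 135 * s ^ 4 + 525 * s ^ 3 + 1080 * s\<^sup>2 + 1080 * s + 360)) (at_right 0)"
    by (rule theta_det_exp_poly_tendsto[THEN tendsto_eq_rhs])
      (simp add: det4_def minor3_def pderiv_pCons numeral_2_eq_2 numeral_3_eq_3, algebra)
  moreover have "(\<lambda>x::real. exp x * poly [:0, 0, 0, 0, 0, 1:] x) = (\<lambda>x. exp x * x ^ 5)"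
    by (simp add: fun_eq_iff power_numeral_reduce)
  ultimately show ?thesis by simp
qed

definition theta_minor :: "real \<Rightarrow> real \<Rightarrow> nat \<Rightarrow> nat \<Rightarrow> nat \<Rightarrow> real" where
  "theta_minor e s = minor3 (\<lambda>k. diff_quot k theta2 e s) (\<lambda>k. diff_quot k theta3 e s) (\<lambda>k. diff_quot k theta4 e s)"

text \<open>Coefficients of the point values of \<open>f\<close> in \<open>theta_det\<close>:
  cofactors with their signs, combined with the binomial coefficients of the forward
  differences.\<close>

definition theta_weight :: "real \<Rightarrow> real \<Rightarrow> nat \<Rightarrow> real" where
  "theta_weight e s j =
    [theta_minor e s 1 2 3 + theta_minor e s 0 2 3 / e + theta_minor e s 0 1 3 / e ^ 2 + theta_minor e s 0 1 2 / e ^ 3,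
     - theta_minor e s 0 2 3 / e - 2 * theta_minor e s 0 1 3 / e ^ 2 - 3 * theta_minor e s 0 1 2 / e ^ 3,
     theta_minor e s 0 1 3 / e ^ 2 + 3 * theta_minor e s 0 1 2 / e ^ 3,
     - theta_minor e s 0 1 2 / e ^ 3] ! j"

lemma nth_list_4:
  "[a, b, c, d] ! 0 = a" "[a, b, c, d] ! 1 = b" "[a, b, c, d] ! 2 = c" "[a, b, c, d] ! 3 = d"
  by simp_all

lemma sum_lessThan_4: "(\<Sum>j<4. f j) = f 0 + f 1 + f 2 + (f 3 :: real)" for f :: "nat \<Rightarrow> real"
  by (simp add: eval_nat_numeral)

lemma less_4_cases:
  assumes "j < (4::nat)" "P 0" "P 1" "P 2" "P 3"
  shows "P j"
proof -
  have "j = 0 \<or> j = 1 \<or> j = 2 \<or> j = 3" using assms(1) by linarith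
  then show ?thesis using assms by blast
qed

lemma theta_det_eq_sum:
  assumes "e \<noteq> 0"
  shows "theta_det f e s = (\<Sum>j<4. theta_weight e s j * f (s + real j * e))"
proof -
  have arg: "s + e + e = s + 2 * e" "s + 2 * e + e = s + 3 * e" by simp_all
  have dq: "diff_quot 1 f e s = (f (s + e) - f s) / e"
    "diff_quot 2 f e s = (f (s + 2 * e) - 2 * f (s + e) + f s) / e ^ 2"
    "diff_quot 3 f e s = (f (s + 3 * e) - 3 * f (s + 2 * e) + 3 * f (s + e) - f s) / e ^ 3"
    using assms by (simp_all add: numeral_2_eq_2 numeral_3_eq_3 arg)
      (simp_all add: field_simps power2_eq_square power3_eq_cube arg)
  have "theta_det f e s = f s * theta_minor e s 1 2 3 - diff_quot 1 f e s * theta_minor e s 0 2 3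
     + diff_quot 2 f e s * theta_minor e s 0 1 3 - diff_quot 3 f e s * theta_minor e s 0 1 2"
    by (simp add: theta_det_def det4_def theta_minor_def)
  then show ?thesis
    unfolding dq sum_lessThan_4 theta_weight_def
    using assms by (simp add: numeral_2_eq_2 numeral_3_eq_3) (simp add: field_simps)
qed

lemma minor3_tendsto:
  assumes "\<And>i. ((\<lambda>e. b e i) \<longlongrightarrow> b' i) F" "\<And>i. ((\<lambda>e. c e i) \<longlongrightarrow> c' i) F"
    "\<And>i. ((\<lambda>e. d e i) \<longlongrightarrow> d' i) F"
  shows "((\<lambda>e. minor3 (b e) (c e) (d e) i j k) \<longlongrightarrow> minor3 b' c' d' i j k) F"
  unfolding minor3_def by (intro tendsto_intros assms)

lemma theta_minor_tendsto:
  obtains l where "((\<lambda>e. theta_minor e s i j k) \<longlongrightarrow> l) (at_right 0)"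
proof -
  have dq: "((\<lambda>e. diff_quot k (poly p) e s) \<longlongrightarrow> poly ((pderiv ^^ k) p) s) (at_right 0)" for k p
    using diff_quot_tendsto[of "\<lambda>i. poly ((pderiv ^^ i) p)", OF poly_derivs] by simp
  show ?thesis
    by (rule that, unfold theta_minor_def theta_poly, rule minor3_tendsto) (rule dq)+
qed

text \<open>The minors converge, so the weights grow at most like e^-3, the scale of the third
  difference. For the later estimate this rate suffices, whatever the limit.\<close>

lemma theta_weight_tendsto:
  assumes "j < 4"
  obtains l where "((\<lambda>e. theta_weight e s j * e ^ 3) \<longlongrightarrow> l) (at_right 0)"
proof -
  obtain l1 where l1: "((\<lambda>e. theta_minor e s 1 2 3) \<longlongrightarrow> l1) (at_right 0)" by (rule theta_minor_tendsto)
  obtain l2 where l2: "((\<lambda>e. theta_minor e s 0 2 3) \<longlongrightarrow> l2) (at_right 0)" by (rule theta_minor_tendsto)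
  obtain l3 where l3: "((\<lambda>e. theta_minor e s 0 1 3) \<longlongrightarrow> l3) (at_right 0)" by (rule theta_minor_tendsto)
  obtain l4 where l4: "((\<lambda>e. theta_minor e s 0 1 2) \<longlongrightarrow> l4) (at_right 0)" by (rule theta_minor_tendsto)
  define h where "h e = 
    [theta_minor e s 1 2 3 * e ^ 3 + theta_minor e s 0 2 3 * e ^ 2 + theta_minor e s 0 1 3 * e + theta_minor e s 0 1 2,
     - theta_minor e s 0 2 3 * e ^ 2 - 2 * theta_minor e s 0 1 3 * e - 3 * theta_minor e s 0 1 2,
     theta_minor e s 0 1 3 * e + 3 * theta_minor e s 0 1 2,
     - theta_minor e s 0 1 2] ! j" for e
  have lim: "((\<lambda>e. theta_minor e s 1 2 3 * e ^ 3 + theta_minor e s 0 2 3 * e ^ 2 + theta_minor e s 0 1 3 * e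
        + theta_minor e s 0 1 2) \<longlongrightarrow> l1 * 0 ^ 3 + l2 * 0 ^ 2 + l3 * 0 + l4) (at_right 0)"
    "((\<lambda>e. - theta_minor e s 0 2 3 * e ^ 2 - 2 * theta_minor e s 0 1 3 * e - 3 * theta_minor e s 0 1 2)
       \<longlongrightarrow> - l2 * 0 ^ 2 - 2 * l3 * 0 - 3 * l4) (at_right 0)"
    "((\<lambda>e. theta_minor e s 0 1 3 * e + 3 * theta_minor e s 0 1 2) \<longlongrightarrow> l3 * 0 + 3 * l4) (at_right 0)"
    "((\<lambda>e. - theta_minor e s 0 1 2) \<longlongrightarrow> - l4) (at_right 0)"
    by (intro tendsto_intros l1 l2 l3 l4)+
  have "\<exists>l. (h \<longlongrightarrow> l) (at_right 0)"
    unfolding h_def by (rule less_4_cases[OF assms]; unfold nth_list_4; rule exI; rule lim)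
  then obtain l where "(h \<longlongrightarrow> l) (at_right 0)" ..
  moreover have "theta_weight e s j * e ^ 3 = h e" if "e > 0" for e
    unfolding theta_weight_def h_def
    by (insert that, rule less_4_cases[OF assms]; unfold nth_list_4)
      (simp_all add: field_simps power2_eq_square power3_eq_cube)
  then have "\<forall>\<^sub>F e in at_right 0. h e = theta_weight e s j * e ^ 3"
    using eventually_at_right_less[of "0::real"] by (auto elim: eventually_mono)
  ultimately have "((\<lambda>e. theta_weight e s j * e ^ 3) \<longlongrightarrow> l) (at_right 0)"
    by (rule Lim_transform_eventually)
  then show ?thesis by (rule that)
qed

section \<open>Four concentric balls with constant inner potential\<close>

text \<open>The exponential undoes the factor \<open>exp (- s)\<close> of each inner potential. The
  denominator makes the weights add up to \<open>1 / (64 * pi\<^sup>2)\<close>, so that the constant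
  term becomes 1.\<close>

definition ball_weight :: "real \<Rightarrow> real \<Rightarrow> nat \<Rightarrow> real" where
  "ball_weight s e j = exp (s + real j * e) * theta_weight e s j / (64 * pi\<^sup>2 * theta_det exp e s)"

lemma ball_weight_sums:
  assumes "e \<noteq> 0" "theta_det exp e s \<noteq> 0"
  shows "(\<Sum>j<4. ball_weight s e j) = 1 / (64 * pi\<^sup>2)"
    and "(\<Sum>j<4. ball_weight s e j * exp (- (s + real j * e)) * theta2 (s + real j * e)) = 0"
    and "(\<Sum>j<4. ball_weight s e j * exp (- (s + real j * e)) * theta3 (s + real j * e)) = 0"
    and "(\<Sum>j<4. ball_weight s e j * exp (- (s + real j * e)) * theta4 (s + real j * e)) = 0"
    and "(\<Sum>j<4. ball_weight s e j * (s + real j * e) ^ 5) =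
       theta_det (\<lambda>x. exp x * x ^ 5) e s / (64 * pi\<^sup>2 * theta_det exp e s)"
proof -
  \<comment> \<open>All five sums are instances: \<open>f = 1\<close> gives the normalisation,
    \<open>exp (- x)\<close> times a theta polynomial a determinant with a repeated row, and
    \<open>x ^ 5\<close> the volume.\<close>
  have gen: "(\<Sum>j<4. ball_weight s e j * f (s + real j * e)) =
      theta_det (\<lambda>x. exp x * f x) e s / (64 * pi\<^sup>2 * theta_det exp e s)" for f
    unfolding theta_det_eq_sum[OF assms(1), of "\<lambda>x. exp x * f x"] ball_weight_def sum_divide_distrib
    by (intro sum.cong) (simp_all add: mult_ac)
  show "(\<Sum>j<4. ball_weight s e j) = 1 / (64 * pi\<^sup>2)"
    using gen[of "\<lambda>_. 1"] assms(2) by simp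
  show "(\<Sum>j<4. ball_weight s e j * (s + real j * e) ^ 5) =
       theta_det (\<lambda>x. exp x * x ^ 5) e s / (64 * pi\<^sup>2 * theta_det exp e s)"
    by (rule gen)
  have zero: "(\<Sum>j<4. ball_weight s e j * exp (- (s + real j * e)) * f (s + real j * e)) = 0"
    if "theta_det f e s = 0" for f
  proof -
    have "exp x * (exp (- x) * f x) = f x" for x by (simp add: exp_minus)
    then show ?thesis using gen[of "\<lambda>x. exp (- x) * f x"] that
      unfolding \<open>\<And>x. exp x * (exp (- x) * f x) = f x\<close> mult.assoc by simp
  qed
  show "(\<Sum>j<4. ball_weight s e j * exp (- (s + real j * e)) * theta2 (s + real j * e)) = 0"
    "(\<Sum>j<4. ball_weight s e j * exp (- (s + real j * e)) * theta3 (s + real j * e)) = 0"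
    "(\<Sum>j<4. ball_weight s e j * exp (- (s + real j * e)) * theta4 (s + real j * e)) = 0"
    by (rule zero; simp add: theta_det_def det4_eq_0)+
qed

lemma theta_det_exp_nonzero:
  assumes "s > 0"
  shows "\<forall>\<^sub>F e in at_right 0. theta_det exp e s \<noteq> 0"
  using assms by (intro tendsto_imp_eventually_ne[OF theta_det_exp_tendsto]) auto

lemma ball_weight_tendsto:
  assumes "s > 0" "j < 4"
  obtains l where "((\<lambda>e. ball_weight s e j * e ^ 3) \<longlongrightarrow> l) (at_right 0)"
proof -
  obtain l where l: "((\<lambda>e. theta_weight e s j * e ^ 3) \<longlongrightarrow> l) (at_right 0)"
    using theta_weight_tendsto[OF assms(2)] .
  have "((\<lambda>e. exp (s + real j * e) * (theta_weight e s j * e ^ 3) / (64 * pi\<^sup>2 * theta_det exp e s)) \<longlongrightarrow>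
      exp (s + real j * 0) * l / (64 * pi\<^sup>2 * (- 2 * exp s * s ^ 5 * (s + 3)))) (at_right 0)"
    using assms by (intro tendsto_intros l theta_det_exp_tendsto) auto
  then show ?thesis using that by (simp add: ball_weight_def mult.assoc)
qed

definition ball5_magnitude :: "real \<Rightarrow> real" where
  "ball5_magnitude R = R ^ 5 / fact 5 +
      (3 * R ^ 5 + 27 * R ^ 4 + 105 * R ^ 3 + 216 * R ^ 2 + 216 * R + 72) / (24 * (R + 3))"

text \<open>\<open>8 * pi\<^sup>2 / 15\<close> is the volume of the unit ball, so the sum is the
  mass of the weighted balls.\<close>

lemma ball_weight_mass_tendsto:
  assumes "s > 0"
  shows "((\<lambda>e. \<Sum>j<4. ball_weight s e j * (8 * pi\<^sup>2 / 15 * (s + real j * e) ^ 5)) \<longlongrightarrow> ball5_magnitude s) (at_right 0)"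
proof -
  let ?p = "s ^ 6 + 18 * s ^ 5 + 135 * s ^ 4 + 525 * s ^ 3 + 1080 * s\<^sup>2 + 1080 * s + 360"
  have "((\<lambda>e. 8 * pi\<^sup>2 / 15 * (theta_det (\<lambda>x. exp x * x ^ 5) e s / (64 * pi\<^sup>2 * theta_det exp e s))) \<longlongrightarrow>
      8 * pi\<^sup>2 / 15 * (- 2 * exp s * s ^ 5 * ?p / (64 * pi\<^sup>2 * (- 2 * exp s * s ^ 5 * (s + 3))))) (at_right 0)"
    using assms by (intro tendsto_intros theta_det_exp_tendsto theta_det_exp_power5_tendsto) auto
  also have "8 * pi\<^sup>2 / 15 * (- 2 * exp s * s ^ 5 * ?p / (64 * pi\<^sup>2 * (- 2 * exp s * s ^ 5 * (s + 3)))) = ?p / (120 * (s + 3))"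
  proof -
    have "8 * q / 15 * (k * P / (64 * q * (k * d))) = P / (120 * d)" if "q \<noteq> 0" "k \<noteq> 0" for q k P d :: real
      using that by simp
    then show ?thesis by this (use assms in auto)
  qed
  also have "\<dots> = ball5_magnitude s"
    using assms by (simp add: ball5_magnitude_def fact_numeral field_simps power_numeral_reduce)
  finally show ?thesis
  proof (rule Lim_transform_eventually)
    show "\<forall>\<^sub>F e in at_right 0. 8 * pi\<^sup>2 / 15 * (theta_det (\<lambda>x. exp x * x ^ 5) e s / (64 * pi\<^sup>2 * theta_det exp e s)) =
       (\<Sum>j<4. ball_weight s e j * (8 * pi\<^sup>2 / 15 * (s + real j * e) ^ 5))"
      using theta_det_exp_nonzero[OF assms] eventually_at_right_less[of "0::real"]
    proof eventually_elim
      case (elim e)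
      then have "e \<noteq> 0" by simp
      note ball_weight_sums(5)[OF this elim(1), symmetric]
      then show ?case by (simp add: sum_distrib_left mult_ac)
    qed
  qed
qed

text \<open>The identity concerns the continued formula, hence holds at every distance
  \<open>p > 0\<close>. The deviation of the true potential from 1 is then exactly the error of the
  continuation.\<close>

lemma weighted_inner_potential:
  assumes "e \<noteq> 0" "theta_det exp e s \<noteq> 0" "p > 0"
  shows "(\<Sum>j<4. ball_weight s e j * inner_potential p (s + real j * e)) = 1"
proof -
  define w where "w j = ball_weight s e j" for j
  define n where "n j = s + real j * e" for j
  have "(\<Sum>j<4. w j * inner_potential p (n j)) =
      64 * pi\<^sup>2 * (\<Sum>j<4. w j) - 4 * pi\<^sup>2 / p ^ 3 *
       (exp p * (p ^ 3 * (\<Sum>j<4. w j * exp (- n j) * theta2 (n j)) - 2 * p ^ 2 * (\<Sum>j<4. w j * exp (- n j) * theta3 (n j))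
           + (p - 1) * (\<Sum>j<4. w j * exp (- n j) * theta4 (n j))) +
        exp (- p) * (p ^ 3 * (\<Sum>j<4. w j * exp (- n j) * theta2 (n j)) + 2 * p ^ 2 * (\<Sum>j<4. w j * exp (- n j) * theta3 (n j))
           + (p + 1) * (\<Sum>j<4. w j * exp (- n j) * theta4 (n j))))"
    unfolding inner_potential_eq[OF assms(3)] sum_lessThan_4 by algebra
  also have "\<dots> = 1"
    unfolding w_def n_def ball_weight_sums[OF assms(1,2)] by simp
  finally show ?thesis by (simp add: w_def n_def)
qed

section \<open>Densities with almost constant potential\<close>

definition ball_density :: "real \<Rightarrow> real \<Rightarrow> real ^ 5 \<Rightarrow> real" where
  "ball_density s e y = (\<Sum>j<4. ball_weight s e j * indicator (cball 0 (s + real j * e)) y)"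

lemma content_cball5:
  fixes c :: "real ^ 5"
  assumes "r \<ge> 0"
  shows "measure lborel (cball c r) = 8 * pi\<^sup>2 / 15 * r ^ 5"
  using content_cball[OF assms, of c] by (simp add: eval_unit_ball_vol)

lemma integrable_indicator_cball:
  "integrable lborel (indicator (cball (c :: 'a::euclidean_space) r) :: 'a \<Rightarrow> real)"
  by (rule integrable_real_indicator) (simp, rule emeasure_lborel_cball_finite)

lemma ball_density_integrable: "integrable lborel (ball_density s e)"
  unfolding ball_density_def[abs_def]
  by (intro Bochner_Integration.integrable_sum integrable_mult_right integrable_indicator_cball)

lemma ball_density_mass:
  assumes "s \<ge> 0" "e \<ge> 0"
  shows "(LINT y|lborel. ball_density s e y) = (\<Sum>j<4. ball_weight s e j * (8 * pi\<^sup>2 / 15 * (s + real j * e) ^ 5))"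
  unfolding ball_density_def[abs_def]
  using assms by (subst Bochner_Integration.integral_sum)
    (auto simp: content_cball5 intro!: integrable_indicator_cball sum.cong)

lemma ball_density_potential:
  "(LINT y|lborel. ball_density s e y * exp (- dist x y)) =
    (\<Sum>j<4. ball_weight s e j * ball_potential x (s + real j * e))"
proof -
  have "(LINT y|lborel. ball_density s e y * exp (- dist x y)) =
      (LINT y|lborel. (\<Sum>j<4. ball_weight s e j * (indicator (cball 0 (s + real j * e)) y * exp (- dist x y))))"
    unfolding ball_density_def sum_distrib_right mult.assoc ..
  also have "\<dots> = (\<Sum>j<4. ball_weight s e j * ball_potential x (s + real j * e))"
    unfolding ball_potential_def
    by (subst Bochner_Integration.integral_sum)
      (auto intro!: integrable_mult_right integrable_exp_dist integrable_indicator_cball)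
  finally show ?thesis .
qed

lemma ball_density_abs_le: "\<bar>ball_density s e y\<bar> \<le> (\<Sum>j<4. \<bar>ball_weight s e j\<bar>)"
  unfolding ball_density_def
  by (rule order_trans[OF sum_abs], rule sum_mono) (auto simp: indicator_def)

lemma ball_density_support:
  assumes "e \<ge> 0" "y \<notin> cball 0 (s + 3 * e)"
  shows "ball_density s e y = 0"
proof -
  have "indicator (cball 0 (s + real j * e)) y = (0 :: real)" if "j < 4" for j
  proof -
    have "real j * e \<le> 3 * e" using that assms(1) by (intro mult_right_mono) auto
    then show ?thesis using assms(2) by (auto simp: indicator_def)
  qed
  then show ?thesis by (simp add: ball_density_def)
qed

locale ball_weights =
  fixes s e :: real
  assumes s: "s > 0" and e: "e > 0" and det: "theta_det exp e s \<noteq> 0"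
begin

definition radial_potential :: "real ^ 5 \<Rightarrow> real" where
  "radial_potential x = (LINT y|lborel. ball_density s e y * exp (- dist x y))"

text \<open>Only balls that do not contain \<open>x\<close> contribute to the right-hand
  side.\<close>

lemma radial_potential_minus_1:
  assumes "x \<noteq> 0"
  shows "radial_potential x - 1 = (\<Sum>j<4. ball_weight s e j *
    (ball_potential x (s + real j * e) - inner_potential (norm x) (s + real j * e)))"
  using weighted_inner_potential[OF _ det, of "norm x"] e assms
  by (simp add: radial_potential_def ball_density_potential right_diff_distrib sum_subtractf)

lemma radial_potential_inside:
  assumes "norm x \<le> s"
  shows "radial_potential x = 1"
proof -
  have nz: "radial_potential x = 1" if "norm x \<le> s" "x \<noteq> 0" for x
  proof -
    have "ball_potential x (s + real j * e) = inner_potential (norm x) (s + real j * e)" for j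
    proof -
      have "0 \<le> real j * e" using e by simp
      then show ?thesis using that s ball_potential_eq[of x "s + real j * e"] by simp
    qed
    then show ?thesis using radial_potential_minus_1[OF that(2)] by simp
  qed
  show ?thesis
  proof (cases "x = 0")
    \<comment> \<open>The closed formula divides by the norm, so the centre is approached through
      nearby points and Lipschitz continuity.\<close>
    case True
    define N where "N = (LINT y|lborel. \<bar>ball_density s e y\<bar>)"
    have N: "N \<ge> 0" by (simp add: N_def)
    have bound: "\<bar>radial_potential 0 - 1\<bar> \<le> 0 + d" if "d > 0" for d
    proof -
      define r where "r = min s (d / (N + 1))"
      have r: "r > 0" "r \<le> s" using s that N by (auto simp: r_def)
      obtain y :: "real ^ 5" where y: "norm y = r" using vector_choose_size[of r] r by auto
      have "radial_potential y = 1" using y r by (intro nz) auto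
      moreover have "\<bar>radial_potential 0 - radial_potential y\<bar> \<le> dist 0 y * N"
        unfolding radial_potential_def N_def by (rule potential_integral_lipschitz[OF ball_density_integrable])
      moreover have "r * N \<le> d"
      proof -
        have "r * N \<le> d / (N + 1) * N" using N by (intro mult_right_mono) (auto simp: r_def)
        also have "\<dots> \<le> d" using N that by (simp add: field_simps)
        finally show ?thesis .
      qed
      ultimately show ?thesis using y by simp
    qed
    have "\<bar>radial_potential 0 - 1\<bar> \<le> 0" by (rule field_le_epsilon) (rule bound)
    then show ?thesis using True by simp
  qed (use nz assms in auto)
qed

lemma radial_potential_outside:
  assumes "s < norm x" "norm x \<le> s + 3 * e"
  shows "\<bar>radial_potential x - 1\<bar> \<le> (\<Sum>j<4. \<bar>ball_weight s e j\<bar>) * (8 * pi\<^sup>2 * exp (3 * e) * (3 * e) ^ 6)"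
proof -
  let ?B = "8 * pi\<^sup>2 * exp (3 * e) * (3 * e) ^ 6"
  have x: "x \<noteq> 0" using assms s by auto
  have "\<bar>ball_potential x (s + real j * e) - inner_potential (norm x) (s + real j * e)\<bar> \<le> ?B" for j
  proof (cases "norm x \<le> s + real j * e")
    case True
    then show ?thesis using ball_potential_eq[OF x, of "s + real j * e"] s e by simp
  next
    case False
    have je: "0 \<le> real j * e" using e by simp
    let ?d = "norm x - (s + real j * e)"
    have d: "0 \<le> ?d" "?d \<le> 3 * e" using False assms je by auto
    have "\<bar>ball_potential x (s + real j * e) - inner_potential (norm x) (s + real j * e)\<bar> \<le>
        8 * pi\<^sup>2 * exp ?d * ?d ^ 6"
      using False s je by (intro outer_potential_bound) auto
    also have "\<dots> \<le> ?B" using d e by (intro mult_mono power_mono) auto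
    finally show ?thesis .
  qed
  note B = this
  show ?thesis
    unfolding radial_potential_minus_1[OF x] sum_distrib_right
    by (rule order_trans[OF sum_abs], rule sum_mono) (use B in \<open>auto simp: abs_mult intro!: mult_left_mono\<close>)
qed

text \<open>The integrand vanishes off the thin shell: the potential is 1 inside it and the density
  is 0 outside. On the shell the sum of the absolute weights bounds the density and also enters the
  potential error, hence its square.\<close>

lemma energy_defect:
  "\<bar>(LINT y|lborel. ball_density s e y * radial_potential y) - (LINT y|lborel. ball_density s e y)\<bar> \<le>
     (\<Sum>j<4. \<bar>ball_weight s e j\<bar>)\<^sup>2 * (8 * pi\<^sup>2 * exp (3 * e) * (3 * e) ^ 6)
       * (8 * pi\<^sup>2 / 15 * ((s + 3 * e) ^ 5 - s ^ 5))"
proof -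
  let ?C = "\<Sum>j<4. \<bar>ball_weight s e j\<bar>" and ?B = "8 * pi\<^sup>2 * exp (3 * e) * (3 * e) ^ 6"
  let ?g = "ball_density s e"
  define D where "D = cball (0 :: real ^ 5) (s + 3 * e) - cball 0 s"
  have C: "?C \<ge> 0" by (intro sum_nonneg) auto
  have D_fin: "emeasure lborel D < \<infinity>"
    by (rule le_less_trans[OF emeasure_mono emeasure_lborel_cball_finite[of 0 "s + 3 * e"]])
      (auto simp: D_def)
  have D_int: "integrable lborel (indicator D :: _ \<Rightarrow> real)"
    using D_fin by (intro integrable_real_indicator) (auto simp: D_def)
  have pw: "\<bar>?g y * radial_potential y - ?g y\<bar> \<le> ?C\<^sup>2 * ?B * indicator D y" for y
  proof (cases "y \<in> D")
    case True
    have "\<bar>?g y * radial_potential y - ?g y\<bar> = \<bar>?g y\<bar> * \<bar>radial_potential y - 1\<bar>"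
      by (simp add: right_diff_distrib flip: abs_mult)
    also have "\<dots> \<le> ?C * (?C * ?B)"
      using True C by (intro mult_mono ball_density_abs_le radial_potential_outside) (auto simp: D_def)
    finally show ?thesis using True by (simp add: power2_eq_square)
  next
    case False
    then consider "norm y \<le> s" | "y \<notin> cball 0 (s + 3 * e)" by (auto simp: D_def)
    then have "?g y * radial_potential y - ?g y = 0"
    proof cases
      case 1
      then show ?thesis by (simp add: radial_potential_inside)
    next
      case 2
      then show ?thesis using ball_density_support[of e y s] e by simp
    qed
    then show ?thesis by (simp add: False)
  qed
  have meas: "radial_potential \<in> borel_measurable borel"
  proof (rule borel_measurable_continuous_onI)
    have "(LINT y|lborel. \<bar>?g y\<bar>)-lipschitz_on UNIV radial_potential"
      unfolding radial_potential_def using potential_integral_lipschitz[OF ball_density_integrable]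
      by (intro lipschitz_onI) (auto simp: dist_real_def mult.commute)
    then show "continuous_on UNIV radial_potential" by (rule lipschitz_on_continuous_on)
  qed
  have g_meas: "?g \<in> borel_measurable borel"
    using borel_measurable_integrable[OF ball_density_integrable] by simp
  have diff_int: "integrable lborel (\<lambda>y. ?g y * radial_potential y - ?g y)"
  proof (rule Bochner_Integration.integrable_bound)
    show "integrable lborel (\<lambda>y. ?C\<^sup>2 * ?B * indicator D y)"
      using D_int by (intro integrable_mult_right)
    show "(\<lambda>y. ?g y * radial_potential y - ?g y) \<in> borel_measurable lborel"
      using meas g_meas by simp
    show "AE y in lborel. norm (?g y * radial_potential y - ?g y) \<le> norm (?C\<^sup>2 * ?B * indicator D y)"
      using order_trans[OF pw abs_ge_self] by simp
  qed
  have gP_int: "integrable lborel (\<lambda>y. ?g y * radial_potential y)"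
    using Bochner_Integration.integrable_add[OF diff_int ball_density_integrable[of s e]] by simp
  have "\<bar>(LINT y|lborel. ?g y * radial_potential y) - (LINT y|lborel. ?g y)\<bar> = \<bar>LINT y|lborel. ?g y * radial_potential y - ?g y\<bar>"
    using gP_int ball_density_integrable by simp
  also have "\<dots> \<le> (LINT y|lborel. \<bar>?g y * radial_potential y - ?g y\<bar>)" by (rule integral_abs_bound)
  also have "\<dots> \<le> (LINT y|lborel. ?C\<^sup>2 * ?B * indicator D y)"
    using diff_int D_int pw by (intro integral_mono) auto
  also have "\<dots> = ?C\<^sup>2 * ?B * measure lborel D"
    by simp
  also have "measure lborel D = 8 * pi\<^sup>2 / 15 * ((s + 3 * e) ^ 5 - s ^ 5)"
  proof -
    have "measure lborel D = measure lborel (cball (0 :: real ^ 5) (s + 3 * e)) - measure lborel (cball (0 :: real ^ 5) s)"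
      unfolding D_def using e by (intro measure_Diff) 
        (use emeasure_lborel_cball_finite[of "0 :: real ^ 5" "s + 3 * e"] in auto)
    then show ?thesis using s e by (simp add: content_cball5 right_diff_distrib)
  qed
  finally show ?thesis .
qed

end

text \<open>The squared weights are of order e^-6 and are exactly compensated by
  \<open>(3 * e) ^ 6\<close>. What makes the product tend to 0 is the vanishing volume of the
  shell.\<close>

lemma energy_defect_tendsto:
  assumes "s > 0"
  shows "((\<lambda>e. (\<Sum>j<4. \<bar>ball_weight s e j\<bar>)\<^sup>2 * (8 * pi\<^sup>2 * exp (3 * e) * (3 * e) ^ 6)
       * (8 * pi\<^sup>2 / 15 * ((s + 3 * e) ^ 5 - s ^ 5))) \<longlongrightarrow> 0) (at_right 0)"
proof -
  have "\<forall>j. \<exists>l. j < 4 \<longrightarrow> ((\<lambda>e. ball_weight s e j * e ^ 3) \<longlongrightarrow> l) (at_right 0)"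
    using ball_weight_tendsto[OF assms] by metis
  then obtain l where l: "\<And>j. j < 4 \<Longrightarrow> ((\<lambda>e. ball_weight s e j * e ^ 3) \<longlongrightarrow> l j) (at_right 0)"
    by metis
  have lim: "((\<lambda>e. (\<Sum>j<4. \<bar>ball_weight s e j * e ^ 3\<bar>)\<^sup>2 * (8 * pi\<^sup>2 * exp (3 * e) * 3 ^ 6)
       * (8 * pi\<^sup>2 / 15 * ((s + 3 * e) ^ 5 - s ^ 5))) \<longlongrightarrow>
     (\<Sum>j<4. \<bar>l j\<bar>)\<^sup>2 * (8 * pi\<^sup>2 * exp (3 * 0) * 3 ^ 6) * (8 * pi\<^sup>2 / 15 * ((s + 3 * 0) ^ 5 - s ^ 5))) (at_right 0)"
    by (intro tendsto_intros l) auto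
  have eq: "(\<Sum>j<4. \<bar>ball_weight s e j * e ^ 3\<bar>)\<^sup>2 * (8 * pi\<^sup>2 * exp (3 * e) * 3 ^ 6)
       * (8 * pi\<^sup>2 / 15 * ((s + 3 * e) ^ 5 - s ^ 5)) =
     (\<Sum>j<4. \<bar>ball_weight s e j\<bar>)\<^sup>2 * (8 * pi\<^sup>2 * exp (3 * e) * (3 * e) ^ 6)
       * (8 * pi\<^sup>2 / 15 * ((s + 3 * e) ^ 5 - s ^ 5))" for e
  proof -
    have "(\<Sum>j<4. \<bar>ball_weight s e j * e ^ 3\<bar>)\<^sup>2 = (\<Sum>j<4. \<bar>ball_weight s e j\<bar>)\<^sup>2 * e ^ 6"
      by (simp add: abs_mult power_mult_distrib power_even_abs flip: sum_distrib_right power_mult)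
    then show ?thesis by (simp add: power_mult_distrib)
  qed
  show ?thesis using lim unfolding eq by simp
qed

text \<open>The gap between \<open>s\<close> and \<open>t\<close> makes room for the balls up to
  radius \<open>s + 3 * e\<close>. The tolerance is split in three: limit of the mass, energy
  defect, discretisation.\<close>

lemma approximate_weighting:
  assumes s: "0 < s" "s < t" and d: "d > 0"
  obtains F :: "(real ^ 5) set" and v where "finite F" "F \<subseteq> cball 0 t"
    "\<bar>(\<Sum>x\<in>F. v x) - ball5_magnitude s\<bar> \<le> d" "\<bar>energy F v - ball5_magnitude s\<bar> \<le> d"
    "\<And>x. norm x \<le> s \<Longrightarrow> \<bar>potential F v x - 1\<bar> \<le> d"
proof -
  have "\<forall>\<^sub>F e in at_right 0. e < (t - s) / 3"
    using s by (intro order_tendstoD[OF tendsto_ident_at]) auto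
  moreover have "\<forall>\<^sub>F e in at_right 0. dist (\<Sum>j<4. ball_weight s e j * (8 * pi\<^sup>2 / 15 * (s + real j * e) ^ 5))
      (ball5_magnitude s) < d / 3"
    using ball_weight_mass_tendsto[OF s(1)] d by (intro tendstoD) auto
  moreover have "\<forall>\<^sub>F e in at_right 0. (\<Sum>j<4. \<bar>ball_weight s e j\<bar>)\<^sup>2 * (8 * pi\<^sup>2 * exp (3 * e) * (3 * e) ^ 6)
       * (8 * pi\<^sup>2 / 15 * ((s + 3 * e) ^ 5 - s ^ 5)) < d / 3"
    using d by (intro order_tendstoD(2)[OF energy_defect_tendsto[OF s(1)]]) auto
  ultimately have "\<forall>\<^sub>F e in at_right 0. e > 0 \<and> theta_det exp e s \<noteq> 0 \<and> e < (t - s) / 3 \<and>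
     dist (\<Sum>j<4. ball_weight s e j * (8 * pi\<^sup>2 / 15 * (s + real j * e) ^ 5)) (ball5_magnitude s) < d / 3 \<and>
     (\<Sum>j<4. \<bar>ball_weight s e j\<bar>)\<^sup>2 * (8 * pi\<^sup>2 * exp (3 * e) * (3 * e) ^ 6)
       * (8 * pi\<^sup>2 / 15 * ((s + 3 * e) ^ 5 - s ^ 5)) < d / 3"
    using theta_det_exp_nonzero[OF s(1)] eventually_at_right_less[of "0::real"]
    by eventually_elim auto
  then obtain e where e: "e > 0" "theta_det exp e s \<noteq> 0" "e < (t - s) / 3"
     "dist (\<Sum>j<4. ball_weight s e j * (8 * pi\<^sup>2 / 15 * (s + real j * e) ^ 5)) (ball5_magnitude s) < d / 3"
     "(\<Sum>j<4. \<bar>ball_weight s e j\<bar>)\<^sup>2 * (8 * pi\<^sup>2 * exp (3 * e) * (3 * e) ^ 6)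
       * (8 * pi\<^sup>2 / 15 * ((s + 3 * e) ^ 5 - s ^ 5)) < d / 3"
    using eventually_happens'[OF trivial_limit_at_right_real] by blast
  interpret B: ball_weights s e by unfold_locales (use s e in auto)
  have supp: "ball_density s e y = 0" if "y \<notin> cball 0 t" for y
  proof (rule ball_density_support)
    have "s + 3 * e \<le> t" using e(3) by (simp add: field_simps)
    then show "y \<notin> cball 0 (s + 3 * e)" using that by auto
  qed (use e in auto)
  obtain F v where F: "finite F" "F \<subseteq> cball 0 t" "(\<Sum>x\<in>F. v x) = (LINT x|lborel. ball_density s e x)"
    "\<And>x. \<bar>potential F v x - B.radial_potential x\<bar> \<le> d / 3"
    "\<bar>energy F v - (LINT x|lborel. ball_density s e x * B.radial_potential x)\<bar> \<le> d / 3"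
    by (rule finite_approximation[OF ball_density_integrable compact_cball supp, where d="d / 3", folded B.radial_potential_def])
      (use d that in auto)
  have mass: "\<bar>(LINT x|lborel. ball_density s e x) - ball5_magnitude s\<bar> < d / 3"
    using e(4) ball_density_mass[of s e] s e(1) by (simp add: dist_real_def)
  show ?thesis
  proof (rule that[OF F(1,2)])
    show "\<bar>(\<Sum>x\<in>F. v x) - ball5_magnitude s\<bar> \<le> d" using mass F(3) d by linarith
    show "\<bar>energy F v - ball5_magnitude s\<bar> \<le> d" using mass F(5) B.energy_defect e(5) by linarith
    show "\<bar>potential F v x - 1\<bar> \<le> d" if "norm x \<le> s" for x
      using F(4)[of x] B.radial_potential_inside[OF that] d by linarith
  qed
qed

section \<open>Translation invariance and the two bounds for the ball\<close>

lemma finite_magnitude_translate: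
  fixes A :: "'a::euclidean_space set"
  assumes "finite A"
  shows "finite_magnitude ((+) c ` A) = finite_magnitude A"
proof -
  obtain w where w: "weighting A w" using weighting_exists[OF assms] .
  have "weighting ((+) c ` A) (\<lambda>x. w (x - c))"
    using w by (simp add: weighting_def sum.reindex)
  then show ?thesis
    using w by (simp add: finite_magnitude_eq sum.reindex)
qed

lemma magnitude_translate:
  fixes X :: "'a::euclidean_space set"
  shows "magnitude ((+) c ` X) = magnitude X"
proof -
  have "{A. finite A \<and> A \<subseteq> (+) c ` X} = (`) ((+) c) ` {A. finite A \<and> A \<subseteq> X}"
  proof (intro equalityI subsetI)
    fix A assume "A \<in> {A. finite A \<and> A \<subseteq> (+) c ` X}"
    then obtain B where "B \<subseteq> X" "finite B" "A = (+) c ` B"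
      using finite_subset_image[of A "(+) c" X] by auto
    then show "A \<in> (`) ((+) c) ` {A. finite A \<and> A \<subseteq> X}" by blast
  qed auto
  then show ?thesis
    unfolding magnitude_def
    by (simp only: image_image) (auto intro!: SUP_cong simp: finite_magnitude_translate)
qed

lemma finite_magnitude_ball5_le:
  fixes A :: "(real ^ 5) set"
  assumes "finite A" "A \<subseteq> cball 0 R" "R > 0"
  shows "finite_magnitude A \<le> ball5_magnitude R"
proof -
  obtain w where w: "weighting A w" using weighting_exists[OF assms(1)] .
  \<comment> \<open>Collects the energy error, counted once, and the potential error, weighted by
    twice the absolute sum of \<open>w\<close>.\<close>
  define W where "W = 1 + 2 * (\<Sum>x\<in>A. \<bar>w x\<bar>)"
  have W: "W > 0" unfolding W_def by (simp add: add_pos_nonneg sum_nonneg)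
  show ?thesis
  proof (rule field_le_epsilon)
    fix d :: real assume "d > 0"
    then have dW: "d / W > 0" using W by simp
    \<comment> \<open>For the upper bound \<open>F\<close> may leave the ball: only the potential on
      \<open>A\<close> matters.\<close>
    obtain F :: "(real ^ 5) set" and v where F: "finite F" "F \<subseteq> cball 0 (R + 1)"
      "\<bar>(\<Sum>x\<in>F. v x) - ball5_magnitude R\<bar> \<le> d / W" "\<bar>energy F v - ball5_magnitude R\<bar> \<le> d / W"
      "\<And>x. norm x \<le> R \<Longrightarrow> \<bar>potential F v x - 1\<bar> \<le> d / W"
      by (rule approximate_weighting[OF assms(3) less_add_one dW]) (rule that)
    have "finite_magnitude A \<le> energy F v + 2 * (d / W) * (\<Sum>x\<in>A. \<bar>w x\<bar>)"
      using assms(2) by (intro finite_magnitude_le[OF assms(1) F(1) w] F(5)) auto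
    also have "\<dots> \<le> ball5_magnitude R + d / W * W"
      using F(4) by (simp only: distrib_left W_def) (simp add: algebra_simps)
    finally show "finite_magnitude A \<le> ball5_magnitude R + d" using W by simp
  qed
qed

lemma magnitude_ball5_ge:
  assumes "0 < s" "s < R"
  shows "ereal (ball5_magnitude s) \<le> magnitude (cball (0 :: real ^ 5) R)"
proof (rule ereal_le_epsilon2)
  fix d :: real assume "0 < d"
  then have d: "0 < d / 3" by simp
  obtain F :: "(real ^ 5) set" and v where F: "finite F" "F \<subseteq> cball 0 R"
    "\<bar>(\<Sum>x\<in>F. v x) - ball5_magnitude s\<bar> \<le> d / 3" "\<bar>energy F v - ball5_magnitude s\<bar> \<le> d / 3"
    "\<And>x. norm x \<le> s \<Longrightarrow> \<bar>potential F v x - 1\<bar> \<le> d / 3"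
    by (rule approximate_weighting[OF assms d]) (rule that)
  \<comment> \<open>Twice the mass loses at most \<open>2 * d / 3\<close> and the energy at most
    another \<open>d / 3\<close>.\<close>
  have "ball5_magnitude s \<le> finite_magnitude F + d"
    using finite_magnitude_ge[OF F(1), of v] F(3,4) by linarith
  then have "ereal (ball5_magnitude s) \<le> ereal (finite_magnitude F) + ereal d" by simp
  also have "\<dots> \<le> magnitude (cball (0 :: real ^ 5) R) + ereal d"
  proof (rule add_right_mono)
    show "ereal (finite_magnitude F) \<le> magnitude (cball (0 :: real ^ 5) R)"
      unfolding magnitude_def by (rule SUP_upper) (use F in auto)
  qed
  finally show "ereal (ball5_magnitude s) \<le> magnitude (cball (0 :: real ^ 5) R) + ereal d" .
qed

theorem theorem3:
  fixes c :: "real ^ 5" and R :: real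
  assumes "R > 0"
  shows "magnitude (cball c R) =
    ereal (R ^ 5 / fact 5 +
      (3 * R ^ 5 + 27 * R ^ 4 + 105 * R ^ 3 + 216 * R ^ 2 + 216 * R + 72) / (24 * (R + 3)))"
proof -
  have "magnitude (cball c R) = magnitude (cball (0 :: real ^ 5) R)"
    using magnitude_translate[of c "cball 0 R"] by (simp add: cball_translation[symmetric])
  also have "\<dots> = ereal (ball5_magnitude R)"
  proof (rule antisym)
    show "magnitude (cball (0 :: real ^ 5) R) \<le> ereal (ball5_magnitude R)"
      unfolding magnitude_def using finite_magnitude_ball5_le assms by (intro SUP_least) auto
    \<comment> \<open>The lower bound needs test weights inside the ball, hence
      \<open>s < R\<close>; continuity of the formula closes the gap.\<close>
    have "((\<lambda>s. ereal (ball5_magnitude s)) \<longlongrightarrow> ereal (ball5_magnitude R)) (at_left R)"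
      unfolding ball5_magnitude_def using assms by (intro tendsto_intros) auto
    moreover have "\<forall>\<^sub>F s in at_left R. ereal (ball5_magnitude s) \<le> magnitude (cball (0 :: real ^ 5) R)"
      using eventually_at_left_real[OF assms] by eventually_elim (auto intro: magnitude_ball5_ge)
    ultimately show "ereal (ball5_magnitude R) \<le> magnitude (cball (0 :: real ^ 5) R)"
      by (intro tendsto_upperbound) auto
  qed
  finally show ?thesis by (simp add: ball5_magnitude_def)
qed

end
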